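(* Let $q=2^e$ with $e>1$. Let $M=\mathrm{Sp}_2(q^2):2$ be the maximal subgroup of $\mathrm{Sp}_4(q)$ obtained by viewing $\mathbb{F}_{q^2}^2$ as the $4$-dimensional $\mathbb{F}_q$-space $\mathbb{F}_q^4$ (so that $\mathrm{Sp}_2(q^2)\le\mathrm{Sp}_4(q)$), extended by the field (Galois) automorphism of order $2$ of $\mathbb{F}_{q^2}$ over $\mathbb{F}_q$. Then $(\mathrm{Sp}_4(q),M)$ is not a strong Gelfand pair.
   Context: All characters are complex. A pair $(G,H)$ with $H\le G$ finite is a strong Gelfand pair if for every irreducible character $\psi$ of $H$, the induced character $\psi\uparrow G$ satisfies $\langle \psi\uparrow G,\chi\rangle\le 1$ for every irreducible character $\chi$ of $G$. $\mathrm{Sp}_4(q)$ is the symplectic group of a nondegenerate alternating form on $\mathbb{F}_q^4$. *)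

theory Defs
  imports "HOL-Algebra.Group" "Jordan_Normal_Form.Matrix" "HOL-Library.Complex_Order"
begin

definition mat_trace :: "complex mat \<Rightarrow> complex" where
  "mat_trace A = (\<Sum>i<dim_row A. A $$ (i, i))"

definition is_rep :: "('g,'b) monoid_scheme \<Rightarrow> nat \<Rightarrow> ('g \<Rightarrow> complex mat) \<Rightarrow> bool" where
  "is_rep G n \<rho> \<longleftrightarrow>
     (\<forall>g\<in>carrier G. \<rho> g \<in> carrier_mat n n) \<and>
     \<rho> \<one>\<^bsub>G\<^esub> = 1\<^sub>m n \<and>
     (\<forall>g\<in>carrier G. \<forall>h\<in>carrier G. \<rho> (g \<otimes>\<^bsub>G\<^esub> h) = \<rho> g * \<rho> h)"

definition invariant_subspace :: "('g,'b) monoid_scheme \<Rightarrow> nat \<Rightarrow> ('g \<Rightarrow> complex mat) \<Rightarrow> complex vec set \<Rightarrow> bool" where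
  "invariant_subspace G n \<rho> W \<longleftrightarrow>
     W \<subseteq> carrier_vec n \<and> 0\<^sub>v n \<in> W \<and>
     (\<forall>v\<in>W. \<forall>w\<in>W. v + w \<in> W) \<and>
     (\<forall>c. \<forall>v\<in>W. c \<cdot>\<^sub>v v \<in> W) \<and>
     (\<forall>g\<in>carrier G. \<forall>v\<in>W. \<rho> g *\<^sub>v v \<in> W)"

definition irr_rep :: "('g,'b) monoid_scheme \<Rightarrow> nat \<Rightarrow> ('g \<Rightarrow> complex mat) \<Rightarrow> bool" where
  "irr_rep G n \<rho> \<longleftrightarrow> 0 < n \<and> is_rep G n \<rho> \<and>
     (\<forall>W. invariant_subspace G n \<rho> W \<longrightarrow> W = {0\<^sub>v n} \<or> W = carrier_vec n)"

definition irr_char :: "('g,'b) monoid_scheme \<Rightarrow> ('g \<Rightarrow> complex) \<Rightarrow> bool" where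
  "irr_char G \<chi> \<longleftrightarrow> (\<exists>n \<rho>. irr_rep G n \<rho> \<and> (\<forall>g\<in>carrier G. \<chi> g = mat_trace (\<rho> g)))"

definition char_inner :: "('g,'b) monoid_scheme \<Rightarrow> ('g \<Rightarrow> complex) \<Rightarrow> ('g \<Rightarrow> complex) \<Rightarrow> complex" where
  "char_inner G \<alpha> \<beta> = (\<Sum>g\<in>carrier G. \<alpha> g * cnj (\<beta> g)) / of_nat (card (carrier G))"

definition induced :: "('g,'b) monoid_scheme \<Rightarrow> 'g set \<Rightarrow> ('g \<Rightarrow> complex) \<Rightarrow> 'g \<Rightarrow> complex" where
  "induced G H \<psi> g =
     (\<Sum>x\<in>carrier G. (let y = x \<otimes>\<^bsub>G\<^esub> g \<otimes>\<^bsub>G\<^esub> inv\<^bsub>G\<^esub> x in if y \<in> H then \<psi> y else 0))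
       / of_nat (card H)"

definition strong_gelfand_pair :: "('g,'b) monoid_scheme \<Rightarrow> 'g set \<Rightarrow> bool" where
  "strong_gelfand_pair G H \<longleftrightarrow>
     (\<forall>\<psi>. irr_char (G\<lparr>carrier := H\<rparr>) \<psi> \<longrightarrow>
        (\<forall>\<chi>. irr_char G \<chi> \<longrightarrow> char_inner G (induced G H \<psi>) \<chi> \<le> 1))"

section \<open>Sp_4(q) on K^2 = F_q^4 (K = F_{q^2}) and the subgroup Sp_2(q^2):2\<close>

text \<open>Subfield F_q of K, for q = 2^e and |K| = q^2.\<close>
definition subfield_q :: "nat \<Rightarrow> 'K::field set" where
  "subfield_q q = {x. x ^ q = x}"

definition psmult :: "'K::field \<Rightarrow> 'K \<times> 'K \<Rightarrow> 'K \<times> 'K" where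
  "psmult c v = (c * fst v, c * snd v)"

definition padd :: "'K::field \<times> 'K \<Rightarrow> 'K \<times> 'K \<Rightarrow> 'K \<times> 'K" where
  "padd u v = (fst u + fst v, snd u + snd v)"

text \<open>Nondegenerate alternating F_q-form on K^2: trace of the K-symplectic form.\<close>
definition sympl_form :: "nat \<Rightarrow> 'K::field \<times> 'K \<Rightarrow> 'K \<times> 'K \<Rightarrow> 'K" where
  "sympl_form q u v = (let d = fst u * snd v - snd u * fst v in d + d ^ q)"

definition Sp4_carrier :: "nat \<Rightarrow> ('K::field \<times> 'K \<Rightarrow> 'K \<times> 'K) set" where
  "Sp4_carrier q = {g. bij g \<and>
       (\<forall>u v. g (padd u v) = padd (g u) (g v)) \<and>
       (\<forall>c\<in>subfield_q q. \<forall>v. g (psmult c v) = psmult c (g v)) \<and>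
       (\<forall>u v. sympl_form q (g u) (g v) = sympl_form q u v)}"

definition Sp4 :: "nat \<Rightarrow> ('K::field \<times> 'K \<Rightarrow> 'K \<times> 'K) monoid" where
  "Sp4 q = \<lparr>carrier = Sp4_carrier q, mult = (\<lambda>g h. g \<circ> h), one = id\<rparr>"

text \<open>Sp_2(q^2):2 : the K-semilinear elements (w.r.t. id or the Frobenius x \<mapsto> x^q).\<close>
definition Sp2_ext_2 :: "nat \<Rightarrow> ('K::field \<times> 'K \<Rightarrow> 'K \<times> 'K) set" where
  "Sp2_ext_2 q = {g \<in> Sp4_carrier q.
       (\<forall>c v. g (psmult c v) = psmult c (g v)) \<or>
       (\<forall>c v. g (psmult c v) = psmult (c ^ q) (g v))}"

end

theory Submission
  imports Defs "Jordan_Normal_Form.Spectral_Radius"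
begin

text \<open>
  If \<open>(G, H)\<close> is a strong Gelfand pair, then by Frobenius reciprocity and Schur's lemma the
  \<open>H\<close>-endomorphisms of every irreducible representation of \<open>G\<close> commute. Hence the sums
  \<open>\<Sum>h\<in>H. h x h\<inverse>\<close> and \<open>\<Sum>k\<in>H. k y k\<inverse>\<close> commute in the group algebra, and comparing the
  coefficients of \<open>x y\<close> gives \<open>h, k \<in> H\<close> with \<open>x y = (k y k\<inverse>) (h x h\<inverse>)\<close>.

  For \<open>Sp_4(q)\<close> this fails for two involutions. Write \<open>bar c = c ^ q\<close> and choose \<open>D\<close> in \<open>F_q\<close>
  different from \<open>0\<close> and \<open>1\<close>, which is possible as \<open>q > 2\<close>. Put \<open>x = 1 + m\<close> and \<open>y = D + n\<close> with
  \<open>m (a, b) = (bar b, 0)\<close> and \<open>n (a, b) = (D bar b, s bar a)\<close>, where \<open>D s = (1 + D)\<^sup>2\<close>. Conjugation by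
  \<open>H\<close> replaces \<open>m\<close>, \<open>n\<close> by semilinear maps \<open>m'\<close>, \<open>n'\<close> with \<open>m' m' = 0\<close>. If
  \<open>(1 + m) (D + n) = (D + n') (1 + m')\<close>, then comparing the \<open>K\<close>-linear and the semilinear parts
  yields \<open>m n = n' m'\<close> and \<open>n + D m = n' + D m'\<close>, so that \<open>m n = (n + D m) m'\<close>. The right-hand
  side has vanishing first component, but \<open>m n (1, 0) = (s, 0)\<close>.
\<close>

section \<open>Sums of matrices and bases of subspaces\<close>

text \<open>At \<open>q = 2\<close> the group is \<open>S_6\<close>, the subgroup is a copy of
  \<open>S_5\<close> of index 6, and this pair is a strong Gelfand pair. The argument must therefore
  break there, and it does so at the choice of \<open>D\<close>. No character table enters: no
  repeated constituent is ever exhibited, its existence is only forced. The elements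
  \<open>x\<close> and \<open>y\<close> come from one family: a scalar \<open>C\<close> plus the
  \<open>bar\<close>-semilinear antidiagonal map with entries \<open>r\<close>, \<open>s\<close>,
  all in \<open>F_q\<close>, is symplectic once \<open>r s = 1 + C^2\<close>. For \<open>x\<close>,
  taking \<open>C = 1\<close> allows \<open>s = 0\<close>, so that the semilinear part squares to
  zero. For \<open>y\<close>, the entry \<open>r\<close> is set equal to \<open>C = D\<close> so
  that it cancels against \<open>D m\<close> in characteristic 2; the condition then forces
  \<open>s = (1 + D)^2 / D\<close>, which vanishes exactly for \<open>D = 1\<close>. The
  representation theory is carried out with explicit complex matrices. A subrepresentation together
  with an equivariant retraction is a pair of rectangular matrices \<open>J\<close>,
  \<open>P\<close> with \<open>P * J = 1\<close>, so neither quotients nor abstract direct sums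
  occur.\<close>

lemma index_mult_mat_sum:
  fixes A B :: "'a::semiring_0 mat"
  assumes "A \<in> carrier_mat m n" "B \<in> carrier_mat n l" "i < m" "j < l"
  shows "(A * B) $$ (i, j) = (\<Sum>t<n. A $$ (i, t) * B $$ (t, j))"
  using assms by (auto simp: scalar_prod_def atLeast0LessThan intro!: sum.cong)

text \<open>Matrices of all sizes share one type, so an empty sum has no canonical zero. The
  dimensions are therefore parameters and the sum is taken entry by entry.\<close>

definition msum :: "nat \<Rightarrow> nat \<Rightarrow> ('i \<Rightarrow> complex mat) \<Rightarrow> 'i set \<Rightarrow> complex mat" where
  "msum nr nc f S = mat nr nc (\<lambda>ij. \<Sum>s\<in>S. f s $$ ij)"

lemma msum_carrier [simp]: "msum nr nc f S \<in> carrier_mat nr nc"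
  by (simp add: msum_def)

lemma msum_index: "i < nr \<Longrightarrow> j < nc \<Longrightarrow> msum nr nc f S $$ (i, j) = (\<Sum>s\<in>S. f s $$ (i, j))"
  by (simp add: msum_def)

lemma msum_cong: "(\<And>s. s \<in> S \<Longrightarrow> f s = g s) \<Longrightarrow> msum nr nc f S = msum nr nc g S"
  by (auto simp: msum_def intro!: eq_matI sum.cong)

lemma msum_reindex:
  "bij_betw \<phi> S T \<Longrightarrow> msum nr nc (\<lambda>s. f (\<phi> s)) S = msum nr nc f T"
  by (auto simp: msum_def sum.reindex_bij_betw[of \<phi> S T "\<lambda>t. f t $$ _"] intro!: eq_matI)

lemma mult_msum:
  assumes "A \<in> carrier_mat m nr" "\<And>s. s \<in> S \<Longrightarrow> f s \<in> carrier_mat nr nc"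
  shows "A * msum nr nc f S = msum m nc (\<lambda>s. A * f s) S"
proof (rule eq_matI)
  fix i j assume "i < dim_row (msum m nc (\<lambda>s. A * f s) S)" "j < dim_col (msum m nc (\<lambda>s. A * f s) S)"
  then have ij: "i < m" "j < nc" by (auto simp: msum_def)
  have "(A * msum nr nc f S) $$ (i, j) = (\<Sum>k<nr. A $$ (i, k) * (\<Sum>s\<in>S. f s $$ (k, j)))"
    using assms(1) ij by (auto simp: msum_def scalar_prod_def atLeast0LessThan intro!: sum.cong)
  also have "\<dots> = (\<Sum>s\<in>S. \<Sum>k<nr. A $$ (i, k) * f s $$ (k, j))"
    by (simp add: sum_distrib_left sum.swap[of _ S])
  also have "\<dots> = (\<Sum>s\<in>S. (A * f s) $$ (i, j))"
  proof (rule sum.cong)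
    fix s assume "s \<in> S"
    from assms(2)[OF this] assms(1) ij
    show "(\<Sum>k<nr. A $$ (i, k) * f s $$ (k, j)) = (A * f s) $$ (i, j)"
      by (auto simp: scalar_prod_def atLeast0LessThan intro!: sum.cong)
  qed simp
  finally show "(A * msum nr nc f S) $$ (i, j) = msum m nc (\<lambda>s. A * f s) S $$ (i, j)"
    using ij by (simp add: msum_index)
qed (use assms in \<open>auto simp: msum_def\<close>)

lemma msum_mult:
  assumes "A \<in> carrier_mat nc m" "\<And>s. s \<in> S \<Longrightarrow> f s \<in> carrier_mat nr nc"
  shows "msum nr nc f S * A = msum nr m (\<lambda>s. f s * A) S"
proof (rule eq_matI)
  fix i j assume "i < dim_row (msum nr m (\<lambda>s. f s * A) S)" "j < dim_col (msum nr m (\<lambda>s. f s * A) S)"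
  then have ij: "i < nr" "j < m" by (auto simp: msum_def)
  have "(msum nr nc f S * A) $$ (i, j) = (\<Sum>k<nc. (\<Sum>s\<in>S. f s $$ (i, k)) * A $$ (k, j))"
    using assms(1) ij by (auto simp: msum_def scalar_prod_def atLeast0LessThan intro!: sum.cong)
  also have "\<dots> = (\<Sum>s\<in>S. \<Sum>k<nc. f s $$ (i, k) * A $$ (k, j))"
    by (simp add: sum_distrib_right sum.swap[of _ S])
  also have "\<dots> = (\<Sum>s\<in>S. (f s * A) $$ (i, j))"
  proof (rule sum.cong)
    fix s assume "s \<in> S"
    from assms(2)[OF this] assms(1) ij
    show "(\<Sum>k<nc. f s $$ (i, k) * A $$ (k, j)) = (f s * A) $$ (i, j)"
      by (auto simp: scalar_prod_def atLeast0LessThan intro!: sum.cong)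
  qed simp
  finally show "(msum nr nc f S * A) $$ (i, j) = msum nr m (\<lambda>s. f s * A) S $$ (i, j)"
    using ij by (simp add: msum_index)
qed (use assms in \<open>auto simp: msum_def\<close>)

lemma msum_const:
  "A \<in> carrier_mat nr nc \<Longrightarrow> msum nr nc (\<lambda>_. A) S = of_nat (card S) \<cdot>\<^sub>m A"
  by (auto simp: msum_def intro!: eq_matI)

lemma mat_trace_msum:
  "(\<And>s. s \<in> S \<Longrightarrow> f s \<in> carrier_mat n n) \<Longrightarrow> mat_trace (msum n n f S) = (\<Sum>s\<in>S. mat_trace (f s))"
proof -
  assume f: "\<And>s. s \<in> S \<Longrightarrow> f s \<in> carrier_mat n n"
  have "mat_trace (msum n n f S) = (\<Sum>s\<in>S. \<Sum>i<n. f s $$ (i, i))"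
    by (simp add: mat_trace_def msum_def sum.swap[of _ S])
  also have "\<dots> = (\<Sum>s\<in>S. mat_trace (f s))"
    by (rule sum.cong) (use f in \<open>auto simp: mat_trace_def dest!: carrier_matD(1)\<close>)
  finally show ?thesis .
qed

lemma mat_trace_comm:
  assumes "A \<in> carrier_mat m n" "B \<in> carrier_mat n m"
  shows "mat_trace (A * B) = mat_trace (B * A)"
proof -
  have "mat_trace (A * B) = (\<Sum>i<m. \<Sum>j<n. A $$ (i, j) * B $$ (j, i))"
    using assms by (auto simp: mat_trace_def scalar_prod_def atLeast0LessThan intro!: sum.cong)
  also have "\<dots> = (\<Sum>j<n. \<Sum>i<m. B $$ (j, i) * A $$ (i, j))"
    by (subst sum.swap) (simp add: mult.commute)
  also have "\<dots> = mat_trace (B * A)"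
    using assms by (auto simp: mat_trace_def scalar_prod_def atLeast0LessThan intro!: sum.cong)
  finally show ?thesis .
qed

lemma mat_trace_one [simp]: "mat_trace (1\<^sub>m n) = of_nat n"
  by (simp add: mat_trace_def)

lemma mat_trace_add:
  "A \<in> carrier_mat n n \<Longrightarrow> B \<in> carrier_mat n n \<Longrightarrow> mat_trace (A + B) = mat_trace A + mat_trace B"
  by (auto simp: mat_trace_def sum.distrib)

section \<open>Left inverses and bases of subspaces\<close>

text \<open>If \<open>n < k\<close>, zero rows in \<open>J\<close> and zero columns in
  \<open>L\<close> pad both to square matrices with \<open>L' * J' = 1\<close>. A one-sided inverse
  of a square matrix is two-sided, so \<open>J' * L' = 1\<close>, although row \<open>n\<close> of
  \<open>J'\<close> is zero.\<close>

lemma left_inverse_dim_le: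
  fixes L :: "'a::field mat"
  assumes L: "L \<in> carrier_mat k n" and J: "J \<in> carrier_mat n k" and LJ: "L * J = 1\<^sub>m k"
  shows "k \<le> n"
proof (rule ccontr)
  assume "\<not> k \<le> n"
  then have nk: "n < k" by simp
  define J' where "J' = mat k k (\<lambda>(i, j). if i < n then J $$ (i, j) else 0)"
  define L' where "L' = mat k k (\<lambda>(i, j). if j < n then L $$ (i, j) else 0)"
  have J': "J' \<in> carrier_mat k k" and L': "L' \<in> carrier_mat k k" by (auto simp: J'_def L'_def)
  have "L' * J' = 1\<^sub>m k"
  proof (rule eq_matI)
    fix i j assume "i < dim_row (1\<^sub>m k)" "j < dim_col (1\<^sub>m k)"
    then have ij: "i < k" "j < k" by auto
    have "(L' * J') $$ (i, j) = (\<Sum>l<k. if l < n then L $$ (i, l) * J $$ (l, j) else 0)"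
      using ij by (auto simp: L'_def J'_def scalar_prod_def atLeast0LessThan intro!: sum.cong)
    also have "\<dots> = (\<Sum>l<n. L $$ (i, l) * J $$ (l, j))"
      using nk by (intro sum.mono_neutral_cong_right) auto
    also have "\<dots> = (L * J) $$ (i, j)"
      using ij L J by (auto simp: scalar_prod_def atLeast0LessThan intro!: sum.cong)
    finally show "(L' * J') $$ (i, j) = 1\<^sub>m k $$ (i, j)" using LJ by simp
  qed (auto simp: L'_def J'_def)
  from mat_mult_left_right_inverse[OF L' J' this] have "J' * L' = 1\<^sub>m k" .
  then have "(J' * L') $$ (n, n) = 1" using nk by simp
  moreover have "(J' * L') $$ (n, n) = 0"
    using nk by (simp add: J'_def L'_def scalar_prod_def)
  ultimately show False by simp
qed

text \<open>The columns of \<open>J\<close> are a basis of \<open>W\<close>, and \<open>L\<close>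
  extends the coordinate map to the whole space, so \<open>J * L\<close> is a projection onto
  \<open>W\<close>. The number \<open>k\<close> is chosen maximal, with
  \<open>left_inverse_dim_le\<close> as the bound; a vector of \<open>W\<close> that
  \<open>J * L\<close> moves would permit one more column.\<close>

lemma subspace_basis:
  fixes W :: "'a::field vec set"
  assumes W: "W \<subseteq> carrier_vec n" "0\<^sub>v n \<in> W" "\<And>v w. v \<in> W \<Longrightarrow> w \<in> W \<Longrightarrow> v + w \<in> W"
    "\<And>c v. v \<in> W \<Longrightarrow> c \<cdot>\<^sub>v v \<in> W"
  shows "\<exists>k J L. J \<in> carrier_mat n k \<and> L \<in> carrier_mat k n \<and> L * J = 1\<^sub>m k \<and>
    (\<forall>v\<in>carrier_vec k. J *\<^sub>v v \<in> W) \<and> (\<forall>w\<in>W. J *\<^sub>v (L *\<^sub>v w) = w)"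
proof -
  define P where "P k \<longleftrightarrow> (\<exists>J L. J \<in> carrier_mat n k \<and> L \<in> carrier_mat k n \<and> L * J = 1\<^sub>m k \<and>
    (\<forall>v\<in>carrier_vec k. J *\<^sub>v v \<in> W))" for k
  have bound: "\<forall>k. P k \<longrightarrow> k \<le> n" unfolding P_def using left_inverse_dim_le by blast
  have "P 0" unfolding P_def
  proof (intro exI conjI ballI)
    show "0\<^sub>m n 0 \<in> carrier_mat n 0" "0\<^sub>m 0 n \<in> carrier_mat 0 n" by auto
    show "0\<^sub>m 0 n * 0\<^sub>m n 0 = (1\<^sub>m 0 :: 'a mat)" by (rule eq_matI) auto
    fix v :: "'a vec" assume "v \<in> carrier_vec 0"
    then have "0\<^sub>m n 0 *\<^sub>v v = 0\<^sub>v n" by (auto intro!: eq_vecI simp: scalar_prod_def)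
    then show "0\<^sub>m n 0 *\<^sub>v v \<in> W" using W(2) by simp
  qed
  then have "P (Greatest P)" and great: "P k \<Longrightarrow> k \<le> Greatest P" for k
    using bound GreatestI_nat[of P 0 n] Greatest_le_nat[of P _ n] by blast+
  then obtain k J L where k: "k = Greatest P" and J: "J \<in> carrier_mat n k" and L: "L \<in> carrier_mat k n"
    and LJ: "L * J = 1\<^sub>m k" and JW: "\<And>v. v \<in> carrier_vec k \<Longrightarrow> J *\<^sub>v v \<in> W"
    unfolding P_def by blast
  have "J *\<^sub>v (L *\<^sub>v w) = w" if w: "w \<in> W" for w
  proof (rule ccontr)
    assume ne: "J *\<^sub>v (L *\<^sub>v w) \<noteq> w"
    have wc: "w \<in> carrier_vec n" using w W by auto
    define Q where "Q = 1\<^sub>m n - J * L"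
    have Q: "Q \<in> carrier_mat n n" using J L by (auto simp: Q_def)
    define u where "u = w + (-1) \<cdot>\<^sub>v (J *\<^sub>v (L *\<^sub>v w))"
    have Lw: "L *\<^sub>v w \<in> carrier_vec k" using L wc by auto
    have uW: "u \<in> W" unfolding u_def using w JW[OF Lw] W by blast
    then have u: "u \<in> carrier_vec n" using W by auto
    have "L *\<^sub>v u = L *\<^sub>v w + (-1) \<cdot>\<^sub>v (L *\<^sub>v (J *\<^sub>v (L *\<^sub>v w)))"
      unfolding u_def using L J wc Lw
      by (simp add: mult_add_distrib_mat_vec[of L k n] mult_mat_vec[of L k n])
    also have "L *\<^sub>v (J *\<^sub>v (L *\<^sub>v w)) = (L * J) *\<^sub>v (L *\<^sub>v w)"
      by (rule assoc_mult_mat_vec[symmetric, OF L J Lw])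
    also have "\<dots> = L *\<^sub>v w" using LJ Lw by simp
    also have "L *\<^sub>v w + (-1) \<cdot>\<^sub>v (L *\<^sub>v w) = 0\<^sub>v k" using L by (intro eq_vecI) auto
    finally have Lu: "L *\<^sub>v u = 0\<^sub>v k" .
    have "Q *\<^sub>v u = u - J *\<^sub>v (L *\<^sub>v u)"
      unfolding Q_def using J L u by (simp add: minus_mult_distrib_mat_vec[of _ n n])
    also have "\<dots> = u" using J u Lu by auto
    finally have Qu: "Q *\<^sub>v u = u" .
    have "Q * J = J - J * (L * J)"
      unfolding Q_def using J L by (simp add: minus_mult_distrib_mat[of _ n n])
    also have "\<dots> = 0\<^sub>m n k" using J LJ by simp
    finally have QJ: "Q * J = 0\<^sub>m n k" .
    have "u \<noteq> 0\<^sub>v n"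
    proof
      assume "u = 0\<^sub>v n"
      have "(J *\<^sub>v (L *\<^sub>v w)) $ i = w $ i" if "i < n" for i
      proof -
        have "u $ i = w $ i - (J *\<^sub>v (L *\<^sub>v w)) $ i" using that J L wc by (simp add: u_def)
        then show ?thesis using \<open>u = 0\<^sub>v n\<close> that by simp
      qed
      then have "J *\<^sub>v (L *\<^sub>v w) = w" using J wc by (intro eq_vecI) auto
      with ne show False by simp
    qed
    then obtain a where a: "a < n" "u $ a \<noteq> 0"
      using u by (metis eq_vecI carrier_vecD index_zero_vec(1) index_zero_vec(2))
    \<comment> \<open>The new column is \<open>u\<close>, the new row is row \<open>a\<close> of
      \<open>Q = 1 - J * L\<close> divided by \<open>u $ a\<close>. This row vanishes on the old
      columns by \<open>Q * J = 0\<close> and is 1 on the new one because \<open>Q\<close> fixes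
      \<open>u\<close>; the old rows vanish on \<open>u\<close> because \<open>L\<close> kills
      it.\<close>
    define J' where "J' = mat n (Suc k) (\<lambda>(i, j). if j < k then J $$ (i, j) else u $ i)"
    define L' where "L' = mat (Suc k) n (\<lambda>(i, j). if i < k then L $$ (i, j) else Q $$ (a, j) / u $ a)"
    have Lu0: "(\<Sum>l<n. L $$ (i, l) * u $ l) = 0" if "i < k" for i
    proof -
      have "(\<Sum>l<n. L $$ (i, l) * u $ l) = (L *\<^sub>v u) $ i"
        using that L u by (auto simp: scalar_prod_def atLeast0LessThan intro!: sum.cong)
      then show ?thesis using Lu that by simp
    qed
    have Qu0: "(\<Sum>l<n. Q $$ (a, l) * u $ l) = u $ a"
    proof -
      have "(\<Sum>l<n. Q $$ (a, l) * u $ l) = (Q *\<^sub>v u) $ a"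
        using a Q u by (auto simp: scalar_prod_def atLeast0LessThan intro!: sum.cong)
      then show ?thesis using Qu by simp
    qed
    have QJ0: "(\<Sum>l<n. Q $$ (a, l) * J $$ (l, j)) = 0" if "j < k" for j
    proof -
      have "(\<Sum>l<n. Q $$ (a, l) * J $$ (l, j)) = (Q * J) $$ (a, j)"
        using that a Q J by (auto simp: scalar_prod_def atLeast0LessThan intro!: sum.cong)
      then show ?thesis using QJ that a by simp
    qed
    have LJ0: "(\<Sum>l<n. L $$ (i, l) * J $$ (l, j)) = (if i = j then 1 else 0)" if "i < k" "j < k" for i j
    proof -
      have "(\<Sum>l<n. L $$ (i, l) * J $$ (l, j)) = (L * J) $$ (i, j)"
        using that L J by (auto simp: scalar_prod_def atLeast0LessThan intro!: sum.cong)
      then show ?thesis using LJ that by simp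
    qed
    have J': "J' \<in> carrier_mat n (Suc k)" and L': "L' \<in> carrier_mat (Suc k) n"
      by (auto simp: J'_def L'_def)
    have "L' * J' = 1\<^sub>m (Suc k)"
    proof (rule eq_matI)
      fix i j assume "i < dim_row (1\<^sub>m (Suc k))" "j < dim_col (1\<^sub>m (Suc k))"
      then have ij: "i < Suc k" "j < Suc k" by auto
      have "(L' * J') $$ (i, j) = (\<Sum>l<n. L' $$ (i, l) * J' $$ (l, j))"
        using ij L' J' by (auto simp: scalar_prod_def atLeast0LessThan intro!: sum.cong)
      also have "\<dots> = (if i < k then (if j < k then (\<Sum>l<n. L $$ (i, l) * J $$ (l, j)) else (\<Sum>l<n. L $$ (i, l) * u $ l))
         else (if j < k then (\<Sum>l<n. Q $$ (a, l) * J $$ (l, j)) / u $ a else (\<Sum>l<n. Q $$ (a, l) * u $ l) / u $ a))"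
        using ij by (auto simp: L'_def J'_def sum_divide_distrib intro!: sum.cong)
      also have "\<dots> = (if i = j then 1 else 0)"
        using ij a by (auto simp: LJ0 Lu0 QJ0 Qu0)
      finally show "(L' * J') $$ (i, j) = 1\<^sub>m (Suc k) $$ (i, j)" using ij by simp
    qed (auto simp: L'_def J'_def)
    moreover have "J' *\<^sub>v v \<in> W" if v: "v \<in> carrier_vec (Suc k)" for v
    proof -
      have "J' *\<^sub>v v = J *\<^sub>v (vec k (\<lambda>i. v $ i)) + (v $ k) \<cdot>\<^sub>v u"
      proof (rule eq_vecI)
        fix i assume "i < dim_vec (J *\<^sub>v (vec k (\<lambda>i. v $ i)) + (v $ k) \<cdot>\<^sub>v u)"
        then have i: "i < n" using u by simp
        have "(J' *\<^sub>v v) $ i = (\<Sum>l<Suc k. J' $$ (i, l) * v $ l)"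
          using i J' v by (auto simp: scalar_prod_def atLeast0LessThan intro!: sum.cong)
        also have "\<dots> = (\<Sum>l<k. J $$ (i, l) * v $ l) + u $ i * v $ k"
          using i by (simp add: J'_def)
        finally show "(J' *\<^sub>v v) $ i = (J *\<^sub>v (vec k (\<lambda>i. v $ i)) + (v $ k) \<cdot>\<^sub>v u) $ i"
          using i J u by (simp add: scalar_prod_def atLeast0LessThan)
      qed (use J' u in auto)
      then show ?thesis using JW[of "vec k (\<lambda>i. v $ i)"] uW W by auto
    qed
    ultimately have "P (Suc k)" unfolding P_def using J' L' by blast
    from great[OF this] k show False by simp
  qed
  with J L LJ JW show ?thesis by blast
qed

section \<open>Representations and Maschke's theorem\<close>

lemma mat_eq_if_mult_vec_eq:
  fixes A B :: "'a::comm_ring_1 mat"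
  assumes "A \<in> carrier_mat nr nc" "B \<in> carrier_mat nr nc"
    and "\<And>v. v \<in> carrier_vec nc \<Longrightarrow> A *\<^sub>v v = B *\<^sub>v v"
  shows "A = B"
proof (rule eq_matI)
  fix i j assume "i < dim_row B" "j < dim_col B"
  then have ij: "i < nr" "j < nc" using assms by auto
  have "A *\<^sub>v unit_vec nc j = B *\<^sub>v unit_vec nc j" using assms(3) by simp
  then have "(A *\<^sub>v unit_vec nc j) $ i = (B *\<^sub>v unit_vec nc j) $ i" by simp
  then show "A $$ (i, j) = B $$ (i, j)" using assms(1,2) ij by simp
qed (use assms in auto)

lemma (in group) bij_betw_mult_left:
  "h \<in> carrier G \<Longrightarrow> bij_betw (\<lambda>g. h \<otimes> g) (carrier G) (carrier G)"
  by (rule bij_betw_byWitness[where f' = "\<lambda>g. inv h \<otimes> g"]) (auto simp: m_assoc[symmetric])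

lemma is_rep_carrier: "is_rep G n \<rho> \<Longrightarrow> g \<in> carrier G \<Longrightarrow> \<rho> g \<in> carrier_mat n n"
  by (simp add: is_rep_def)

lemma is_rep_mult:
  "is_rep G n \<rho> \<Longrightarrow> g \<in> carrier G \<Longrightarrow> h \<in> carrier G \<Longrightarrow> \<rho> (g \<otimes>\<^bsub>G\<^esub> h) = \<rho> g * \<rho> h"
  by (simp add: is_rep_def)

lemma is_rep_one: "is_rep G n \<rho> \<Longrightarrow> \<rho> \<one>\<^bsub>G\<^esub> = 1\<^sub>m n"
  by (simp add: is_rep_def)

lemma (in group) is_rep_inv:
  assumes "is_rep G n \<rho>" "g \<in> carrier G"
  shows "\<rho> g * \<rho> (inv g) = 1\<^sub>m n" "\<rho> (inv g) * \<rho> g = 1\<^sub>m n"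
  using is_rep_mult[OF assms(1), of g "inv g"] is_rep_mult[OF assms(1), of "inv g" g]
    is_rep_one[OF assms(1)] assms(2) by auto

lemma irr_rep_is_rep: "irr_rep G n \<rho> \<Longrightarrow> is_rep G n \<rho>"
  by (simp add: irr_rep_def)

section \<open>Intertwiners, averaging and compressions\<close>

text \<open>\<open>T\<close> maps the space of \<open>\<tau>\<close> to that of
  \<open>\<sigma>\<close>; the target comes first so that the arguments follow the shape
  \<open>n\<close> by \<open>k\<close> of the matrix.\<close>

definition intertwiner ::
    "('g,'b) monoid_scheme \<Rightarrow> nat \<Rightarrow> ('g \<Rightarrow> complex mat) \<Rightarrow> nat \<Rightarrow> ('g \<Rightarrow> complex mat) \<Rightarrow> complex mat \<Rightarrow> bool" where
  "intertwiner G n \<sigma> k \<tau> T \<longleftrightarrow> T \<in> carrier_mat n k \<and> (\<forall>g\<in>carrier G. \<sigma> g * T = T * \<tau> g)"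

lemma intertwiner_mult:
  assumes "is_rep G n \<sigma>" "is_rep G m \<tau>" "is_rep G k \<upsilon>"
    and "intertwiner G n \<sigma> m \<tau> S" "intertwiner G m \<tau> k \<upsilon> T"
  shows "intertwiner G n \<sigma> k \<upsilon> (S * T)"
  unfolding intertwiner_def
proof (intro conjI ballI)
  have c: "S \<in> carrier_mat n m" "T \<in> carrier_mat m k" using assms by (auto simp: intertwiner_def)
  then show "S * T \<in> carrier_mat n k" by simp
  fix g assume g: "g \<in> carrier G"
  note cg = is_rep_carrier[OF assms(1) g] is_rep_carrier[OF assms(2) g] is_rep_carrier[OF assms(3) g]
  have "\<sigma> g * (S * T) = (\<sigma> g * S) * T"
    by (rule assoc_mult_mat[symmetric, OF cg(1) c])
  also have "\<dots> = (S * \<tau> g) * T" using assms g by (simp add: intertwiner_def)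
  also have "\<dots> = S * (\<tau> g * T)" by (rule assoc_mult_mat[OF c(1) cg(2) c(2)])
  also have "\<dots> = S * (T * \<upsilon> g)" using assms g by (simp add: intertwiner_def)
  also have "\<dots> = S * T * \<upsilon> g" by (rule assoc_mult_mat[symmetric, OF c cg(3)])
  finally show "\<sigma> g * (S * T) = S * T * \<upsilon> g" .
qed

text \<open>Substituting \<open>h \<otimes> g\<close> for \<open>g\<close> pulls
  \<open>\<sigma> h\<close> out on the left while \<open>\<tau> h\<close> cancels on the right.
  Different choices of \<open>X\<close> yield the projection in Maschke's theorem, an invariant
  Hermitian form, the orthogonality relations and the sums of \<open>H\<close>-conjugates.\<close>

lemma (in group) intertwiner_average:
  assumes \<sigma>: "is_rep G n \<sigma>" and \<tau>: "is_rep G k \<tau>" and X: "X \<in> carrier_mat n k"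
  shows "intertwiner G n \<sigma> k \<tau> (msum n k (\<lambda>g. \<sigma> g * X * \<tau> (inv g)) (carrier G))"
  unfolding intertwiner_def
proof (intro conjI ballI)
  fix h assume h: "h \<in> carrier G"
  note cs = is_rep_carrier[OF \<sigma>] and ct = is_rep_carrier[OF \<tau>]
  have c: "\<sigma> g * X * \<tau> (inv g) \<in> carrier_mat n k" if "g \<in> carrier G" for g
    using cs[OF that] ct[of "inv g"] that X by auto
  have "msum n k (\<lambda>g. \<sigma> g * X * \<tau> (inv g)) (carrier G) * \<tau> h
      = msum n k (\<lambda>g. \<sigma> g * X * \<tau> (inv g) * \<tau> h) (carrier G)"
    by (rule msum_mult[OF ct[OF h] c])
  also have "\<dots> = msum n k (\<lambda>g. \<sigma> (h \<otimes> g) * X * \<tau> (inv (h \<otimes> g)) * \<tau> h) (carrier G)"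
    by (rule msum_reindex[OF bij_betw_mult_left[OF h], symmetric])
  also have "\<dots> = msum n k (\<lambda>g. \<sigma> h * (\<sigma> g * X * \<tau> (inv g))) (carrier G)"
  proof (rule msum_cong)
    fix g assume g: "g \<in> carrier G"
    have ch: "\<sigma> h \<in> carrier_mat n n" "\<sigma> g \<in> carrier_mat n n" "\<tau> (inv g) \<in> carrier_mat k k"
      "\<tau> (inv h) \<in> carrier_mat k k" "\<tau> h \<in> carrier_mat k k"
      using cs ct g h by auto
    have "\<sigma> (h \<otimes> g) * X * \<tau> (inv (h \<otimes> g)) * \<tau> h
        = (\<sigma> h * \<sigma> g) * X * (\<tau> (inv g) * \<tau> (inv h)) * \<tau> h"
      using g h by (simp add: is_rep_mult[OF \<sigma>] is_rep_mult[OF \<tau>] inv_mult_group)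
    also have "\<dots> = (\<sigma> h * \<sigma> g) * X * ((\<tau> (inv g) * \<tau> (inv h)) * \<tau> h)"
      by (rule assoc_mult_mat[of _ n k _ k _ k]) (use ch X in auto)
    also have "(\<tau> (inv g) * \<tau> (inv h)) * \<tau> h = \<tau> (inv g) * (\<tau> (inv h) * \<tau> h)"
      by (rule assoc_mult_mat[of _ k k _ k _ k]) (use ch in auto)
    also have "\<dots> = \<tau> (inv g)" using is_rep_inv[OF \<tau> h] ch by simp
    also have "(\<sigma> h * \<sigma> g) * X * \<tau> (inv g) = \<sigma> h * (\<sigma> g * X * \<tau> (inv g))"
      using ch X by (simp add: assoc_mult_mat[of _ n n _ n _ k] assoc_mult_mat[of _ n n _ k _ k])
    finally show "\<sigma> (h \<otimes> g) * X * \<tau> (inv (h \<otimes> g)) * \<tau> h = \<sigma> h * (\<sigma> g * X * \<tau> (inv g))" .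
  qed
  also have "\<dots> = \<sigma> h * msum n k (\<lambda>g. \<sigma> g * X * \<tau> (inv g)) (carrier G)"
    by (rule mult_msum[symmetric, OF cs[OF h] c])
  finally show "\<sigma> h * msum n k (\<lambda>g. \<sigma> g * X * \<tau> (inv g)) (carrier G)
      = msum n k (\<lambda>g. \<sigma> g * X * \<tau> (inv g)) (carrier G) * \<tau> h" by simp
qed simp

text \<open>\<open>J\<close> embeds \<open>\<tau>\<close> into \<open>\<sigma>\<close> and \<open>P\<close> is an equivariant retraction.\<close>
definition split_rep ::
    "('g,'b) monoid_scheme \<Rightarrow> nat \<Rightarrow> ('g \<Rightarrow> complex mat) \<Rightarrow> nat \<Rightarrow> ('g \<Rightarrow> complex mat) \<Rightarrow> complex mat \<Rightarrow> complex mat \<Rightarrow> bool" where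
  "split_rep G n \<sigma> k \<tau> J P \<longleftrightarrow> is_rep G k \<tau> \<and> P * J = 1\<^sub>m k \<and>
     intertwiner G n \<sigma> k \<tau> J \<and> intertwiner G k \<tau> n \<sigma> P"

text \<open>By \<open>P * J = 1\<close> the matrix \<open>J * P\<close> is idempotent. Since it
  commutes with every \<open>\<sigma> g\<close>, inserting it between two factors and compressing
  loses nothing, which makes the compression multiplicative.\<close>

lemma (in group) split_rep_compression:
  assumes \<sigma>: "is_rep G n \<sigma>" and J: "J \<in> carrier_mat n k" and P: "P \<in> carrier_mat k n"
    and PJ: "P * J = 1\<^sub>m k" and comm: "intertwiner G n \<sigma> n \<sigma> (J * P)"
  shows "split_rep G n \<sigma> k (\<lambda>g. P * \<sigma> g * J) J P"
proof -
  note cs = is_rep_carrier[OF \<sigma>]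
  have 1: "\<sigma> g * J = J * (P * \<sigma> g * J)" if g: "g \<in> carrier G" for g
  proof -
    have "\<sigma> g * J = \<sigma> g * (J * (P * J))" using PJ J by simp
    also have "\<dots> = \<sigma> g * (J * P) * J"
      using cs[OF g] J P by (simp add: assoc_mult_mat[of _ n k _ n _ k] assoc_mult_mat[of _ n n _ n _ k])
    also have "\<sigma> g * (J * P) = J * P * \<sigma> g" using comm g by (simp add: intertwiner_def)
    also have "J * P * \<sigma> g * J = J * (P * \<sigma> g * J)"
      using cs[OF g] J P by (simp add: assoc_mult_mat[of _ n k _ n _ n] assoc_mult_mat[of _ n k _ n _ k]
        assoc_mult_mat[of _ k n _ n _ k] assoc_mult_mat[of _ n n _ n _ k])
    finally show ?thesis .
  qed
  have 2: "P * \<sigma> g * J * P = P * \<sigma> g" if g: "g \<in> carrier G" for g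
  proof -
    have "P * \<sigma> g * J * P = P * (\<sigma> g * (J * P))"
      using cs[OF g] J P by (simp add: assoc_mult_mat[of _ k n _ n _ k] assoc_mult_mat[of _ k n _ k _ n] assoc_mult_mat[of _ n n _ k _ n])
    also have "\<sigma> g * (J * P) = J * P * \<sigma> g" using comm g by (simp add: intertwiner_def)
    also have "P * (J * P * \<sigma> g) = (P * J) * P * \<sigma> g"
      using cs[OF g] J P by (simp add: assoc_mult_mat[of _ k n _ k _ n] assoc_mult_mat[of _ n k _ n _ n]
          assoc_mult_mat[of _ k k _ n _ n] assoc_mult_mat[of _ k n _ n _ n])
    also have "\<dots> = P * \<sigma> g" using PJ P by simp
    finally show ?thesis .
  qed
  have "is_rep G k (\<lambda>g. P * \<sigma> g * J)" unfolding is_rep_def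
  proof (intro conjI ballI)
    fix g assume g: "g \<in> carrier G"
    show "P * \<sigma> g * J \<in> carrier_mat k k" using cs[OF g] J P by auto
    fix h assume h: "h \<in> carrier G"
    have "P * \<sigma> (g \<otimes> h) * J = P * \<sigma> g * (\<sigma> h * J)"
      using cs[OF g] cs[OF h] J P g h
      by (simp add: is_rep_mult[OF \<sigma>] assoc_mult_mat[of _ k n _ n _ k] assoc_mult_mat[of _ n n _ n _ k])
    also have "\<dots> = P * \<sigma> g * (J * (P * \<sigma> h * J))" using 1[OF h] by simp
    also have "\<dots> = P * \<sigma> g * J * (P * \<sigma> h * J)"
      by (rule assoc_mult_mat[symmetric, of _ k n _ k _ k]) (use cs[OF g] cs[OF h] J P in auto)
    finally show "P * \<sigma> (g \<otimes> h) * J = P * \<sigma> g * J * (P * \<sigma> h * J)" .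
  next
    show "P * \<sigma> \<one> * J = 1\<^sub>m k" using is_rep_one[OF \<sigma>] P PJ by simp
  qed
  then show ?thesis
    unfolding split_rep_def intertwiner_def using 1 2 J P PJ by auto
qed

lemma split_rep_trans:
  assumes \<sigma>: "is_rep G n \<sigma>" and 1: "split_rep G n \<sigma> m \<tau> J P" and 2: "split_rep G m \<tau> k \<upsilon> J' P'"
  shows "split_rep G n \<sigma> k \<upsilon> (J * J') (P' * P)"
proof -
  have c: "J \<in> carrier_mat n m" "P \<in> carrier_mat m n" "J' \<in> carrier_mat m k" "P' \<in> carrier_mat k m"
    using 1 2 by (auto simp: split_rep_def intertwiner_def)
  have r: "is_rep G m \<tau>" "is_rep G k \<upsilon>" using 1 2 by (auto simp: split_rep_def)
  have "P' * P * (J * J') = P' * (P * J * J')"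
    using c by (simp add: assoc_mult_mat[of _ k m _ n _ k] assoc_mult_mat[of _ m n _ m _ k])
  also have "\<dots> = 1\<^sub>m k" using c 1 2 by (simp add: split_rep_def)
  finally have "P' * P * (J * J') = 1\<^sub>m k" .
  then show ?thesis
    using 1 2 r intertwiner_mult[OF \<sigma> r, of J J'] intertwiner_mult[OF r(2,1) \<sigma>, of P' P]
    by (simp add: split_rep_def)
qed

text \<open>The fixed vectors of an idempotent are its image, and \<open>J\<close> is a basis of
  them. The retraction has to be \<open>L * Q\<close>, because \<open>L\<close> is controlled only
  on that image.\<close>

lemma idempotent_factor:
  fixes Q :: "'a::field mat"
  assumes Q: "Q \<in> carrier_mat n n" and QQ: "Q * Q = Q"
  obtains k J P where "J \<in> carrier_mat n k" "P \<in> carrier_mat k n" "P * J = 1\<^sub>m k" "J * P = Q"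
proof -
  define W where "W = {v \<in> carrier_vec n. Q *\<^sub>v v = v}"
  have W: "W \<subseteq> carrier_vec n" "0\<^sub>v n \<in> W" "\<And>v w. v \<in> W \<Longrightarrow> w \<in> W \<Longrightarrow> v + w \<in> W"
    "\<And>c v. v \<in> W \<Longrightarrow> c \<cdot>\<^sub>v v \<in> W"
    using Q by (auto simp: W_def mult_add_distrib_mat_vec[of Q n n] mult_mat_vec[of Q n n])
  obtain k J L where J: "J \<in> carrier_mat n k" and L: "L \<in> carrier_mat k n"
    and LJ: "L * J = 1\<^sub>m k" and JW: "\<And>v. v \<in> carrier_vec k \<Longrightarrow> J *\<^sub>v v \<in> W"
    and JL: "\<And>w. w \<in> W \<Longrightarrow> J *\<^sub>v (L *\<^sub>v w) = w" using subspace_basis[OF W] by blast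
  have QJ: "Q * J = J"
    by (rule mat_eq_if_mult_vec_eq[of _ n k]) (use Q J JW in \<open>auto simp: W_def\<close>)
  have "J * (L * Q) = Q"
  proof (rule mat_eq_if_mult_vec_eq[of _ n n])
    fix v :: "'a vec" assume v: "v \<in> carrier_vec n"
    have "Q *\<^sub>v v \<in> W" using v Q QQ assoc_mult_mat_vec[OF Q Q v] by (simp add: W_def del: assoc_mult_mat_vec)
    then have "J *\<^sub>v (L *\<^sub>v (Q *\<^sub>v v)) = Q *\<^sub>v v" by (rule JL)
    then show "J * (L * Q) *\<^sub>v v = Q *\<^sub>v v"
      using J L Q v by (simp add: assoc_mult_mat_vec[of J n k _ n] assoc_mult_mat_vec[of L k n _ n])
  qed (use J L Q in auto)
  moreover have "L * Q * J = 1\<^sub>m k"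
    using L Q J QJ LJ by (simp add: assoc_mult_mat[of L k n Q n J k])
  ultimately show ?thesis using that[of J k "L * Q"] J L Q by auto
qed

text \<open>Averaging the projection \<open>J * L\<close> onto \<open>W\<close> gives an equivariant
  idempotent \<open>E\<close> with image \<open>W\<close>, and \<open>1 - E\<close> supplies the
  complement. Both summands are returned in factored form and with smaller dimension, as an
  induction requires.\<close>

lemma (in group) maschke:
  assumes fin: "finite (carrier G)" and \<sigma>: "is_rep G n \<sigma>"
    and inv: "invariant_subspace G n \<sigma> W" and ne: "W \<noteq> {0\<^sub>v n}" "W \<noteq> carrier_vec n"
  obtains k\<^sub>1 \<tau>\<^sub>1 J\<^sub>1 P\<^sub>1 k\<^sub>2 \<tau>\<^sub>2 J\<^sub>2 P\<^sub>2
  where "split_rep G n \<sigma> k\<^sub>1 \<tau>\<^sub>1 J\<^sub>1 P\<^sub>1" "split_rep G n \<sigma> k\<^sub>2 \<tau>\<^sub>2 J\<^sub>2 P\<^sub>2"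
    "J\<^sub>1 * P\<^sub>1 + J\<^sub>2 * P\<^sub>2 = 1\<^sub>m n" "k\<^sub>1 < n" "k\<^sub>2 < n"
proof -
  note cs = is_rep_carrier[OF \<sigma>]
  have W: "W \<subseteq> carrier_vec n" "0\<^sub>v n \<in> W" "\<And>v w. v \<in> W \<Longrightarrow> w \<in> W \<Longrightarrow> v + w \<in> W"
    "\<And>c v. v \<in> W \<Longrightarrow> c \<cdot>\<^sub>v v \<in> W" and Winv: "\<And>g v. g \<in> carrier G \<Longrightarrow> v \<in> W \<Longrightarrow> \<sigma> g *\<^sub>v v \<in> W"
    using inv by (auto simp: invariant_subspace_def)
  obtain k J L where J: "J \<in> carrier_mat n k" and L: "L \<in> carrier_mat k n"
    and LJ: "L * J = 1\<^sub>m k" and JW: "\<And>v. v \<in> carrier_vec k \<Longrightarrow> J *\<^sub>v v \<in> W"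
    and JL: "\<And>w. w \<in> W \<Longrightarrow> J *\<^sub>v (L *\<^sub>v w) = w" using subspace_basis[OF W] by blast
  have JLs: "J * (L * (\<sigma> g * J)) = \<sigma> g * J" if g: "g \<in> carrier G" for g
  proof (rule mat_eq_if_mult_vec_eq[of _ n k])
    fix v :: "complex vec" assume v: "v \<in> carrier_vec k"
    have "J *\<^sub>v (L *\<^sub>v (\<sigma> g *\<^sub>v (J *\<^sub>v v))) = \<sigma> g *\<^sub>v (J *\<^sub>v v)"
      by (rule JL, rule Winv[OF g], rule JW[OF v])
    then show "J * (L * (\<sigma> g * J)) *\<^sub>v v = \<sigma> g * J *\<^sub>v v"
      using J L cs[OF g] v by (simp add: assoc_mult_mat_vec[of J n k _ k] assoc_mult_mat_vec[of L k n _ k]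
        assoc_mult_mat_vec[of "\<sigma> g" n n _ k])
  qed (use J L cs[OF g] in auto)
  define c where "c = (1 / of_nat (card (carrier G)) :: complex)"
  have card: "c * of_nat (card (carrier G)) = 1"
    using fin by (auto simp: c_def)
  define M where "M = msum n n (\<lambda>g. \<sigma> g * (J * L) * \<sigma> (inv g)) (carrier G)"
  \<comment> \<open>\<open>N\<close> is the average \<open>M\<close> with its leading factor
    \<open>J\<close> removed. Invariance of \<open>W\<close> makes this possible, since it gives
    \<open>\<sigma> g * J = J * (L * (\<sigma> g * J))\<close>; the same basis \<open>J\<close> then
    serves for \<open>E\<close>.\<close>
  define N where "N = msum k n (\<lambda>g. L * \<sigma> g * (J * L) * \<sigma> (inv g)) (carrier G)"
  define P where "P = c \<cdot>\<^sub>m N"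
  have Nc: "N \<in> carrier_mat k n" and Pc: "P \<in> carrier_mat k n" by (auto simp: N_def P_def)
  have Nterm: "L * \<sigma> g * (J * L) * \<sigma> (inv g) \<in> carrier_mat k n" if g: "g \<in> carrier G" for g
    by (intro mult_carrier_mat[of _ k n _ n] mult_carrier_mat[OF J] L cs g inv_closed)
  have JN: "J * N = M"
  proof -
    have "J * N = msum n n (\<lambda>g. J * (L * \<sigma> g * (J * L) * \<sigma> (inv g))) (carrier G)"
      unfolding N_def by (rule mult_msum[OF J Nterm])
    also have "\<dots> = M" unfolding M_def
    proof (rule msum_cong)
      fix g assume g: "g \<in> carrier G"
      have c: "\<sigma> g \<in> carrier_mat n n" "\<sigma> (inv g) \<in> carrier_mat n n" using cs g by auto
      have "J * (L * \<sigma> g * (J * L) * \<sigma> (inv g)) = J * (L * (\<sigma> g * J)) * (L * \<sigma> (inv g))"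
        using J L c by (simp add: assoc_mult_mat[of _ k n _ n _ n] assoc_mult_mat[of _ n n _ n _ n]
          assoc_mult_mat[of _ n k _ n _ n] assoc_mult_mat[of _ k n _ k _ n] assoc_mult_mat[of _ n k _ k _ n]
          assoc_mult_mat[of _ n n _ k _ n])
      also have "\<dots> = \<sigma> g * (J * L) * \<sigma> (inv g)"
        unfolding JLs[OF g] using J L c by (simp add: assoc_mult_mat[of _ n n _ n _ n]
          assoc_mult_mat[of _ n k _ n _ n] assoc_mult_mat[of _ n n _ k _ n])
      finally show "J * (L * \<sigma> g * (J * L) * \<sigma> (inv g)) = \<sigma> g * (J * L) * \<sigma> (inv g)" .
    qed
    finally show ?thesis .
  qed
  have NJ: "N * J = of_nat (card (carrier G)) \<cdot>\<^sub>m 1\<^sub>m k"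
  proof -
    have "N * J = msum k k (\<lambda>g. L * \<sigma> g * (J * L) * \<sigma> (inv g) * J) (carrier G)"
      unfolding N_def by (rule msum_mult[OF J Nterm])
    also have "\<dots> = msum k k (\<lambda>g. 1\<^sub>m k) (carrier G)"
    proof (rule msum_cong)
      fix g assume g: "g \<in> carrier G"
      have c: "\<sigma> g \<in> carrier_mat n n" "\<sigma> (inv g) \<in> carrier_mat n n" using cs g by auto
      have "L * \<sigma> g * (J * L) * \<sigma> (inv g) * J = L * (\<sigma> g * (J * (L * (\<sigma> (inv g) * J))))"
        using J L c by (simp add: assoc_mult_mat[of _ k n _ n _ n] assoc_mult_mat[of _ k n _ n _ k]
          assoc_mult_mat[of _ n k _ n _ k] assoc_mult_mat[of _ n n _ n _ n] assoc_mult_mat[of _ n n _ n _ k]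
          assoc_mult_mat[of _ n k _ n _ n])
      also have "J * (L * (\<sigma> (inv g) * J)) = \<sigma> (inv g) * J" using JLs g by simp
      also have "\<sigma> g * (\<sigma> (inv g) * J) = \<sigma> g * \<sigma> (inv g) * J"
        using J c by (simp add: assoc_mult_mat[of _ n n _ n _ k])
      also have "\<dots> = J" using is_rep_inv[OF \<sigma> g] J by simp
      finally show "L * \<sigma> g * (J * L) * \<sigma> (inv g) * J = 1\<^sub>m k" using LJ by simp
    qed
    finally show ?thesis by (simp add: msum_const)
  qed
  have PJ: "P * J = 1\<^sub>m k"
    unfolding P_def mult_smult_assoc_mat[OF Nc J] NJ
    using card by (auto simp flip: mult.assoc intro!: eq_matI)
  define E where "E = J * P"
  have E: "E \<in> carrier_mat n n" using J Pc by (simp add: E_def)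
  have EM: "E = c \<cdot>\<^sub>m M" unfolding E_def P_def JN[symmetric] by (rule mult_smult_distrib[OF J Nc])
  have "intertwiner G n \<sigma> n \<sigma> M"
    unfolding M_def by (rule intertwiner_average[OF \<sigma> \<sigma>]) (use J L in simp)
  then have EI: "intertwiner G n \<sigma> n \<sigma> E"
    unfolding EM intertwiner_def using cs
    by (auto simp: mult_smult_distrib[of _ n n _ n] mult_smult_assoc_mat[of _ n n _ n])
  have EE: "E * E = E"
  proof -
    have "E * E = J * (P * J * P)"
      unfolding E_def using J Pc by (simp add: assoc_mult_mat[of _ n k _ n _ n] assoc_mult_mat[of _ k n _ k _ n])
    then show ?thesis using PJ Pc by (simp add: E_def)
  qed
  define Q where "Q = 1\<^sub>m n - E"
  have Q: "Q \<in> carrier_mat n n" using E by (simp add: Q_def minus_carrier_mat)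
  have QQ: "Q * Q = Q"
  proof -
    have "Q * Q = 1\<^sub>m n * Q - E * Q" unfolding Q_def by (rule minus_mult_distrib_mat[of _ n n _ _ n]) (use E in auto)
    also have "E * Q = E * 1\<^sub>m n - E * E" unfolding Q_def by (rule mult_minus_distrib_mat[of _ n n _ n]) (use E in auto)
    also have "\<dots> = 0\<^sub>m n n" using EE E by simp
    also have "1\<^sub>m n * Q - 0\<^sub>m n n = Q" using Q by auto
    finally show ?thesis .
  qed
  have QI: "intertwiner G n \<sigma> n \<sigma> Q"
    unfolding intertwiner_def
  proof (intro conjI ballI)
    fix g assume g: "g \<in> carrier G"
    have "\<sigma> g * Q = \<sigma> g * 1\<^sub>m n - \<sigma> g * E" unfolding Q_def
      by (rule mult_minus_distrib_mat[of _ n n _ n]) (use E cs g in auto)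
    also have "\<dots> = 1\<^sub>m n * \<sigma> g - E * \<sigma> g" using EI cs[OF g] g by (simp add: intertwiner_def)
    also have "\<dots> = Q * \<sigma> g" unfolding Q_def
      by (rule minus_mult_distrib_mat[symmetric, of _ n n _ _ n]) (use E cs g in auto)
    finally show "\<sigma> g * Q = Q * \<sigma> g" .
  qed (rule Q)
  from idempotent_factor[OF Q QQ] obtain k' J' P' where J': "J' \<in> carrier_mat n k'" and
    P': "P' \<in> carrier_mat k' n" and PJ': "P' * J' = 1\<^sub>m k'" and JP': "J' * P' = Q" .
  have s1: "split_rep G n \<sigma> k (\<lambda>g. P * \<sigma> g * J) J P"
    using split_rep_compression[OF \<sigma> J Pc PJ] EI by (simp add: E_def)
  have s2: "split_rep G n \<sigma> k' (\<lambda>g. P' * \<sigma> g * J') J' P'"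
    using split_rep_compression[OF \<sigma> J' P' PJ'] QI JP' by simp
  have sum: "J * P + J' * P' = 1\<^sub>m n"
    unfolding JP' Q_def E_def[symmetric] using E by (auto intro!: eq_matI)
  \<comment> \<open>The trace of an idempotent is its rank, so the two dimensions add up to
    \<open>n\<close>. It remains to see that neither is zero.\<close>
  have "of_nat (k + k') = mat_trace (P * J) + mat_trace (P' * J')" using PJ PJ' by simp
  also have "\<dots> = mat_trace (J * P) + mat_trace (J' * P')"
    using mat_trace_comm[OF J Pc] mat_trace_comm[OF J' P'] by simp
  also have "\<dots> = mat_trace (J * P + J' * P')"
    using J Pc J' P' by (simp add: mat_trace_add[of _ n])
  also have "\<dots> = of_nat n" using sum by simp
  finally have kk: "k + k' = n" using of_nat_eq_iff by blast
  have "k \<noteq> 0"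
  proof
    assume "k = 0"
    have "w = 0\<^sub>v n" if "w \<in> W" for w
    proof -
      have "J *\<^sub>v (L *\<^sub>v w) = 0\<^sub>v n" using J L \<open>k = 0\<close> by (intro eq_vecI) (auto simp: scalar_prod_def)
      then show ?thesis using JL[OF that] by simp
    qed
    then show False using ne(1) W(2) by blast
  qed
  moreover have "k' \<noteq> 0"
  proof
    assume "k' = 0"
    then have "J' * P' = 0\<^sub>m n n" using J' P' by (intro eq_matI) (auto simp: scalar_prod_def)
    then have "J * P = 1\<^sub>m n" using sum J Pc by simp
    have "v \<in> W" if v: "v \<in> carrier_vec n" for v
    proof -
      have "v = J *\<^sub>v (P *\<^sub>v v)"
        using v unfolding assoc_mult_mat_vec[OF J Pc v, symmetric] \<open>J * P = 1\<^sub>m n\<close> by simp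
      moreover have "P *\<^sub>v v \<in> carrier_vec k" using v Pc by simp
      ultimately show ?thesis using JW by metis
    qed
    then show False using ne(2) W(1) by blast
  qed
  ultimately have "k < n" "k' < n" using kk by auto
  with s1 s2 sum that show ?thesis by blast
qed

section \<open>Decomposition into irreducibles and Schur's lemma\<close>

definition constituent ::
    "('g,'b) monoid_scheme \<Rightarrow> nat \<Rightarrow> ('g \<Rightarrow> complex mat) \<Rightarrow>
      nat \<times> ('g \<Rightarrow> complex mat) \<times> complex mat \<times> complex mat \<Rightarrow> bool" where
  "constituent G n \<sigma> = (\<lambda>(k, \<tau>, J, P). irr_rep G k \<tau> \<and> split_rep G n \<sigma> k \<tau> J P)"

definition projector :: "nat \<times> ('g \<Rightarrow> complex mat) \<times> complex mat \<times> complex mat \<Rightarrow> complex mat" where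
  "projector = (\<lambda>(k, \<tau>, J, P). J * P)"

text \<open>The constituents are tied together by the completeness relation for their projectors.
  Isomorphic constituents may recur, and counting them gives the multiplicity.\<close>

definition decomposes ::
    "('g,'b) monoid_scheme \<Rightarrow> nat \<Rightarrow> ('g \<Rightarrow> complex mat) \<Rightarrow> nat \<Rightarrow>
      (nat \<Rightarrow> nat \<times> ('g \<Rightarrow> complex mat) \<times> complex mat \<times> complex mat) \<Rightarrow> bool" where
  "decomposes G n \<sigma> r d \<longleftrightarrow> (\<forall>i<r. constituent G n \<sigma> (d i)) \<and>
     msum n n (\<lambda>i. projector (d i)) {..<r} = 1\<^sub>m n"

lemma projector_carrier: "constituent G n \<sigma> d \<Longrightarrow> projector d \<in> carrier_mat n n"
  by (cases d) (auto simp: constituent_def projector_def split_rep_def intertwiner_def)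

lemma sum_lessThan_add: "(\<Sum>i<a + b. f i) = (\<Sum>i<a. f i) + (\<Sum>i<b. f (a + i :: nat))" for f :: "nat \<Rightarrow> 'a::comm_monoid_add"
  by (induction b) (simp_all add: add.assoc)

lemma decomposes_add:
  assumes \<sigma>: "is_rep G n \<sigma>"
    and 1: "split_rep G n \<sigma> k\<^sub>1 \<tau>\<^sub>1 J\<^sub>1 P\<^sub>1" and 2: "split_rep G n \<sigma> k\<^sub>2 \<tau>\<^sub>2 J\<^sub>2 P\<^sub>2"
    and sum: "J\<^sub>1 * P\<^sub>1 + J\<^sub>2 * P\<^sub>2 = 1\<^sub>m n"
    and d1: "decomposes G k\<^sub>1 \<tau>\<^sub>1 r\<^sub>1 d\<^sub>1" and d2: "decomposes G k\<^sub>2 \<tau>\<^sub>2 r\<^sub>2 d\<^sub>2"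
  shows "\<exists>d. decomposes G n \<sigma> (r\<^sub>1 + r\<^sub>2) d"
proof -
  define lift where "lift = (\<lambda>J' P' (k :: nat, \<tau> :: 'a \<Rightarrow> complex mat, J, P). (k, \<tau>, J' * J :: complex mat, P * P' :: complex mat))"
  have lift: "constituent G n \<sigma> (lift J' P' d)" "projector (lift J' P' d) = J' * projector d * P'"
    if "split_rep G n \<sigma> k' \<tau>' J' P'" "constituent G k' \<tau>' d" for k' \<tau>' J' P' d
  proof -
    obtain k \<tau> J P where d: "d = (k, \<tau>, J, P)" by (cases d)
    show "constituent G n \<sigma> (lift J' P' d)"
      using that split_rep_trans[OF \<sigma> that(1)] by (auto simp: d lift_def constituent_def)
    have c: "J' \<in> carrier_mat n k'" "P' \<in> carrier_mat k' n" "J \<in> carrier_mat k' k" "P \<in> carrier_mat k k'"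
      using that by (auto simp: d constituent_def split_rep_def intertwiner_def)
    then show "projector (lift J' P' d) = J' * projector d * P'"
      by (simp add: d lift_def projector_def assoc_mult_mat[of _ n k' _ k _ n] assoc_mult_mat[of _ k' k _ k' _ n]
        assoc_mult_mat[of _ n k' _ k' _ n])
  qed
  have part: "msum n n (\<lambda>i. projector (lift J' P' (d' i))) {..<r'} = J' * P'"
    if s: "split_rep G n \<sigma> k' \<tau>' J' P'" and d: "decomposes G k' \<tau>' r' d'" for k' \<tau>' J' P' r' d'
  proof -
    have c: "J' \<in> carrier_mat n k'" "P' \<in> carrier_mat k' n"
      using s by (auto simp: split_rep_def intertwiner_def)
    have di: "constituent G k' \<tau>' (d' i)" if "i < r'" for i using d that by (simp add: decomposes_def)
    have pc: "projector (d' i) \<in> carrier_mat k' k'" if "i \<in> {..<r'}" for i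
      using projector_carrier[OF di] that by simp
    have "msum n n (\<lambda>i. projector (lift J' P' (d' i))) {..<r'} = msum n n (\<lambda>i. J' * projector (d' i) * P') {..<r'}"
      by (rule msum_cong) (use lift(2)[OF s di] in auto)
    also have "\<dots> = msum n k' (\<lambda>i. J' * projector (d' i)) {..<r'} * P'"
      by (rule msum_mult[symmetric, OF c(2) mult_carrier_mat[OF c(1) pc]])
    also have "msum n k' (\<lambda>i. J' * projector (d' i)) {..<r'} = J' * msum k' k' (\<lambda>i. projector (d' i)) {..<r'}"
      by (rule mult_msum[symmetric, OF c(1) pc])
    also have "\<dots> = J'" using d c by (simp add: decomposes_def)
    finally show ?thesis .
  qed
  define d where "d = (\<lambda>i. if i < r\<^sub>1 then lift J\<^sub>1 P\<^sub>1 (d\<^sub>1 i) else lift J\<^sub>2 P\<^sub>2 (d\<^sub>2 (i - r\<^sub>1)))"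
  have "msum n n (\<lambda>i. projector (d i)) {..<r\<^sub>1 + r\<^sub>2}
      = msum n n (\<lambda>i. projector (lift J\<^sub>1 P\<^sub>1 (d\<^sub>1 i))) {..<r\<^sub>1} + msum n n (\<lambda>i. projector (lift J\<^sub>2 P\<^sub>2 (d\<^sub>2 i))) {..<r\<^sub>2}"
    by (intro eq_matI) (auto simp: msum_def sum_lessThan_add d_def)
  also have "\<dots> = 1\<^sub>m n" unfolding part[OF 1 d1] part[OF 2 d2] by (rule sum)
  finally have "msum n n (\<lambda>i. projector (d i)) {..<r\<^sub>1 + r\<^sub>2} = 1\<^sub>m n" .
  moreover have "constituent G n \<sigma> (d i)" if "i < r\<^sub>1 + r\<^sub>2" for i
    using that d1 d2 lift(1)[OF 1] lift(1)[OF 2] by (auto simp: d_def decomposes_def)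
  ultimately show ?thesis by (auto simp: decomposes_def)
qed

text \<open>Induction on the dimension by \<open>maschke\<close>. Dimension zero is a case of its
  own, with no constituents, because \<open>irr_rep\<close> demands a positive dimension.\<close>

lemma (in group) ex_decomposition:
  assumes fin: "finite (carrier G)"
  shows "is_rep G n \<sigma> \<Longrightarrow> \<exists>r d. decomposes G n \<sigma> r d"
proof (induction n arbitrary: \<sigma> rule: less_induct)
  case (less n)
  note \<sigma> = less.prems
  consider "n = 0" | "irr_rep G n \<sigma>" | W where "invariant_subspace G n \<sigma> W" "W \<noteq> {0\<^sub>v n}" "W \<noteq> carrier_vec n"
    using \<sigma> by (auto simp: irr_rep_def)
  then show ?case
  proof cases
    case 1
    then have "decomposes G n \<sigma> 0 d" for d by (auto simp: decomposes_def msum_def)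
    then show ?thesis by blast
  next
    case 2
    have c: "\<And>g. g \<in> carrier G \<Longrightarrow> \<sigma> g \<in> carrier_mat n n" by (rule is_rep_carrier[OF \<sigma>])
    have "split_rep G n \<sigma> n \<sigma> (1\<^sub>m n) (1\<^sub>m n)"
      using \<sigma> c by (auto simp: split_rep_def intertwiner_def left_mult_one_mat[OF c] right_mult_one_mat[OF c])
    then have "decomposes G n \<sigma> 1 (\<lambda>_. (n, \<sigma>, 1\<^sub>m n, 1\<^sub>m n))"
      using 2 by (auto simp: decomposes_def constituent_def projector_def msum_def intro!: eq_matI)
    then show ?thesis by blast
  next
    case 3
    obtain k\<^sub>1 \<tau>\<^sub>1 J\<^sub>1 P\<^sub>1 k\<^sub>2 \<tau>\<^sub>2 J\<^sub>2 P\<^sub>2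
      where s: "split_rep G n \<sigma> k\<^sub>1 \<tau>\<^sub>1 J\<^sub>1 P\<^sub>1" "split_rep G n \<sigma> k\<^sub>2 \<tau>\<^sub>2 J\<^sub>2 P\<^sub>2"
        "J\<^sub>1 * P\<^sub>1 + J\<^sub>2 * P\<^sub>2 = 1\<^sub>m n" "k\<^sub>1 < n" "k\<^sub>2 < n"
      by (rule maschke[OF fin \<sigma> 3])
    have "is_rep G k\<^sub>1 \<tau>\<^sub>1" "is_rep G k\<^sub>2 \<tau>\<^sub>2" using s(1,2) by (simp_all add: split_rep_def)
    with less.IH s(4,5) obtain r\<^sub>1 d\<^sub>1 r\<^sub>2 d\<^sub>2
      where "decomposes G k\<^sub>1 \<tau>\<^sub>1 r\<^sub>1 d\<^sub>1" "decomposes G k\<^sub>2 \<tau>\<^sub>2 r\<^sub>2 d\<^sub>2" by metis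
    from decomposes_add[OF \<sigma> s(1-3) this] show ?thesis by blast
  qed
qed

section \<open>Schur's lemma\<close>

text \<open>Kernel and range of \<open>T\<close> are invariant subspaces, hence trivial or
  everything, and \<open>T\<close> is nonzero; so \<open>T\<close> is bijective. Equal dimensions
  are not presupposed: \<open>T * S = 1\<close> comes from preimages of the unit vectors and
  \<open>S * T = 1\<close> from injectivity.\<close>

lemma schur_inverse:
  assumes \<sigma>: "irr_rep G n \<sigma>" and \<tau>: "irr_rep G k \<tau>" and T: "intertwiner G n \<sigma> k \<tau> T" and ne: "T \<noteq> 0\<^sub>m n k"
  obtains S where "S \<in> carrier_mat k n" "T * S = 1\<^sub>m n" "S * T = 1\<^sub>m k"
proof -
  have cT: "T \<in> carrier_mat n k" and com: "\<And>g. g \<in> carrier G \<Longrightarrow> \<sigma> g * T = T * \<tau> g"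
    using T by (auto simp: intertwiner_def)
  note cs = is_rep_carrier[OF irr_rep_is_rep[OF \<sigma>]] and ct = is_rep_carrier[OF irr_rep_is_rep[OF \<tau>]]
  have comv: "\<sigma> g *\<^sub>v (T *\<^sub>v v) = T *\<^sub>v (\<tau> g *\<^sub>v v)" if g: "g \<in> carrier G" and v: "v \<in> carrier_vec k" for g v
    using assoc_mult_mat_vec[OF cs[OF g] cT v] assoc_mult_mat_vec[OF cT ct[OF g] v] com[OF g] by metis
  define K where "K = {v \<in> carrier_vec k. T *\<^sub>v v = 0\<^sub>v n}"
  have "invariant_subspace G k \<tau> K"
    unfolding invariant_subspace_def
  proof (intro conjI ballI allI)
    show "K \<subseteq> carrier_vec k" by (auto simp: K_def)
    show "0\<^sub>v k \<in> K" using cT by (auto simp: K_def)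
    show "v + w \<in> K" if "v \<in> K" "w \<in> K" for v w
      using that cT by (auto simp: K_def mult_add_distrib_mat_vec[OF cT])
    show "c \<cdot>\<^sub>v v \<in> K" if "v \<in> K" for c v
      using that cT by (auto simp: K_def mult_mat_vec[OF cT])
    show "\<tau> g *\<^sub>v v \<in> K" if g: "g \<in> carrier G" and v: "v \<in> K" for g v
    proof -
      have "\<sigma> g *\<^sub>v 0\<^sub>v n = 0\<^sub>v n" using cs[OF g] by (intro eq_vecI) auto
      then show ?thesis
        using v comv[OF g, of v] mult_mat_vec_carrier[OF ct[OF g]] by (auto simp: K_def)
    qed
  qed
  then have "K = {0\<^sub>v k} \<or> K = carrier_vec k" using \<tau> by (simp add: irr_rep_def)
  moreover have "K \<noteq> carrier_vec k"
  proof
    assume "K = carrier_vec k"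
    then have z: "T *\<^sub>v v = 0\<^sub>v n" if "v \<in> carrier_vec k" for v using that unfolding K_def by blast
    have "T = 0\<^sub>m n k" by (rule mat_eq_if_mult_vec_eq[OF cT]) (auto simp: z intro!: eq_vecI)
    with ne show False by simp
  qed
  ultimately have K: "K = {0\<^sub>v k}" by simp
  define R where "R = (\<lambda>v. T *\<^sub>v v) ` carrier_vec k"
  have "invariant_subspace G n \<sigma> R"
    unfolding invariant_subspace_def
  proof (intro conjI ballI allI)
    show "R \<subseteq> carrier_vec n" using cT by (auto simp: R_def)
    show "0\<^sub>v n \<in> R" unfolding R_def using cT by (intro image_eqI[of _ _ "0\<^sub>v k"]) auto
    show "x + y \<in> R" if xy: "x \<in> R" "y \<in> R" for x y
    proof -
      obtain v w where "x = T *\<^sub>v v" "y = T *\<^sub>v w" "v \<in> carrier_vec k" "w \<in> carrier_vec k"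
        using xy by (auto simp: R_def)
      then show ?thesis unfolding R_def
        by (intro image_eqI[of _ _ "v + w"]) (auto simp: mult_add_distrib_mat_vec[OF cT])
    qed
    show "c \<cdot>\<^sub>v x \<in> R" if x: "x \<in> R" for c x
    proof -
      obtain v where "x = T *\<^sub>v v" "v \<in> carrier_vec k" using x by (auto simp: R_def)
      then show ?thesis unfolding R_def
        by (intro image_eqI[of _ _ "c \<cdot>\<^sub>v v"]) (auto simp: mult_mat_vec[OF cT])
    qed
    show "\<sigma> g *\<^sub>v x \<in> R" if g: "g \<in> carrier G" and x: "x \<in> R" for g x
    proof -
      obtain v where "x = T *\<^sub>v v" "v \<in> carrier_vec k" using x by (auto simp: R_def)
      then show ?thesis unfolding R_def using comv[OF g, of v] mult_mat_vec_carrier[OF ct[OF g]] by auto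
    qed
  qed
  then have "R = {0\<^sub>v n} \<or> R = carrier_vec n" using \<sigma> by (simp add: irr_rep_def)
  moreover have "R \<noteq> {0\<^sub>v n}"
  proof
    assume "R = {0\<^sub>v n}"
    then have z: "T *\<^sub>v v = 0\<^sub>v n" if "v \<in> carrier_vec k" for v using that unfolding R_def by blast
    have "T = 0\<^sub>m n k" by (rule mat_eq_if_mult_vec_eq[OF cT]) (auto simp: z intro!: eq_vecI)
    with ne show False by simp
  qed
  ultimately have R: "R = carrier_vec n" by simp
  have "\<exists>v. v \<in> carrier_vec k \<and> T *\<^sub>v v = unit_vec n j" for j
  proof -
    have "unit_vec n j \<in> R" unfolding R by simp
    then show ?thesis unfolding R_def by auto
  qed
  then obtain s where s: "\<And>j. s j \<in> carrier_vec k" "\<And>j. T *\<^sub>v s j = unit_vec n j" by metis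
  define S where "S = mat k n (\<lambda>(i, j). s j $ i)"
  have S: "S \<in> carrier_mat k n" by (simp add: S_def)
  have cS: "col S j = s j" if "j < n" for j using s(1)[of j] that by (auto simp: S_def intro!: eq_vecI)
  have TS: "T * S = 1\<^sub>m n"
  proof (rule eq_matI)
    fix i j assume "i < dim_row (1\<^sub>m n)" "j < dim_col (1\<^sub>m n)"
    then have ij: "i < n" "j < n" by auto
    have "(T * S) $$ (i, j) = (T *\<^sub>v s j) $ i" using ij cT S cS by simp
    then show "(T * S) $$ (i, j) = 1\<^sub>m n $$ (i, j)" using ij s(2) by auto
  qed (use cT S in auto)
  have "S * T = 1\<^sub>m k"
  proof (rule mat_eq_if_mult_vec_eq[of _ k k])
    fix v :: "complex vec" assume v: "v \<in> carrier_vec k"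
    define w where "w = S *\<^sub>v (T *\<^sub>v v) - v"
    have Tv: "T *\<^sub>v v \<in> carrier_vec n" and STv: "S *\<^sub>v (T *\<^sub>v v) \<in> carrier_vec k" using cT S v by auto
    have "T *\<^sub>v w = T *\<^sub>v (S *\<^sub>v (T *\<^sub>v v)) - T *\<^sub>v v"
      unfolding w_def by (rule mult_minus_distrib_mat_vec[OF cT STv v])
    also have "T *\<^sub>v (S *\<^sub>v (T *\<^sub>v v)) = T *\<^sub>v v"
      using assoc_mult_mat_vec[OF cT S Tv] TS Tv by simp
    also have "T *\<^sub>v v - T *\<^sub>v v = 0\<^sub>v n" using Tv by simp
    finally have "w \<in> K" using STv v by (simp add: K_def w_def)
    then have w: "w = 0\<^sub>v k" using K by simp
    have "S *\<^sub>v (T *\<^sub>v v) = v"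
    proof (rule eq_vecI)
      fix i assume i: "i < dim_vec v"
      have "w $ i = (S *\<^sub>v (T *\<^sub>v v)) $ i - v $ i" using i v by (simp add: w_def)
      then show "(S *\<^sub>v (T *\<^sub>v v)) $ i = v $ i" using w i v by simp
    qed (use S v in auto)
    then show "S * T *\<^sub>v v = 1\<^sub>m k *\<^sub>v v" using assoc_mult_mat_vec[OF S cT v] v by simp
  qed (use S cT in auto)
  with S TS that show ?thesis by blast
qed

text \<open>Over the complex numbers \<open>T\<close> has an eigenvalue \<open>c\<close>. The
  intertwiner \<open>T - c\<close> kills an eigenvector, so it is not invertible and must
  vanish.\<close>

lemma schur_scalar:
  assumes \<tau>: "irr_rep G k \<tau>" and T: "intertwiner G k \<tau> k \<tau> T"
  obtains c where "T = c \<cdot>\<^sub>m 1\<^sub>m k"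
proof -
  have cT: "T \<in> carrier_mat k k" and com: "\<And>g. g \<in> carrier G \<Longrightarrow> \<tau> g * T = T * \<tau> g"
    using T by (auto simp: intertwiner_def)
  note ct = is_rep_carrier[OF irr_rep_is_rep[OF \<tau>]]
  have "k > 0" using \<tau> by (simp add: irr_rep_def)
  then obtain c where "eigenvalue T c"
    using spectrum_non_empty[OF cT] by (auto simp: spectrum_def)
  then obtain v where v: "v \<in> carrier_vec k" "v \<noteq> 0\<^sub>v k" "T *\<^sub>v v = c \<cdot>\<^sub>v v"
    using cT by (auto simp: eigenvalue_def eigenvector_def)
  define U where "U = T - c \<cdot>\<^sub>m 1\<^sub>m k"
  have cU: "U \<in> carrier_mat k k" using cT by (auto simp: U_def)
  have "intertwiner G k \<tau> k \<tau> U"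
    unfolding intertwiner_def
  proof (intro conjI ballI)
    fix g assume g: "g \<in> carrier G"
    have "\<tau> g * U = \<tau> g * T - \<tau> g * (c \<cdot>\<^sub>m 1\<^sub>m k)"
      unfolding U_def by (rule mult_minus_distrib_mat[of _ k k _ k]) (use ct[OF g] cT in auto)
    also have "\<tau> g * (c \<cdot>\<^sub>m 1\<^sub>m k) = (c \<cdot>\<^sub>m 1\<^sub>m k) * \<tau> g"
      using ct[OF g] by (simp add: mult_smult_distrib[of _ k k _ k] mult_smult_assoc_mat[of _ k k _ k])
    also have "\<tau> g * T - (c \<cdot>\<^sub>m 1\<^sub>m k) * \<tau> g = U * \<tau> g"
      unfolding U_def com[OF g] by (rule minus_mult_distrib_mat[symmetric, of _ k k _ _ k]) (use ct[OF g] cT in auto)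
    finally show "\<tau> g * U = U * \<tau> g" .
  qed (rule cU)
  moreover have "U *\<^sub>v v = 0\<^sub>v k"
  proof -
    have "U *\<^sub>v v = T *\<^sub>v v - (c \<cdot>\<^sub>m 1\<^sub>m k) *\<^sub>v v"
      unfolding U_def by (rule minus_mult_distrib_mat_vec[of _ k k]) (use cT v in auto)
    also have "(c \<cdot>\<^sub>m 1\<^sub>m k) *\<^sub>v v = c \<cdot>\<^sub>v v" using v(1) by (auto intro!: eq_vecI)
    finally show ?thesis using v by simp
  qed
  moreover have "v = 0\<^sub>v k" if S: "S \<in> carrier_mat k k" "S * U = 1\<^sub>m k" "U *\<^sub>v v = 0\<^sub>v k" for S
  proof -
    have "v = S *\<^sub>v (U *\<^sub>v v)" using assoc_mult_mat_vec[OF S(1) cU v(1)] S(2) v(1) by simp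
    also have "\<dots> = 0\<^sub>v k" unfolding S(3) using S(1) by (intro eq_vecI) auto
    finally show ?thesis .
  qed
  ultimately have "U = 0\<^sub>m k k" using schur_inverse[OF \<tau> \<tau>, of U] v(2) by metis
  have "T = c \<cdot>\<^sub>m 1\<^sub>m k"
  proof (rule eq_matI)
    fix i j assume "i < dim_row (c \<cdot>\<^sub>m 1\<^sub>m k)" "j < dim_col (c \<cdot>\<^sub>m 1\<^sub>m k)"
    then have ij: "i < k" "j < k" by auto
    then have "U $$ (i, j) = T $$ (i, j) - (c \<cdot>\<^sub>m 1\<^sub>m k) $$ (i, j)" using cT by (simp add: U_def)
    then show "T $$ (i, j) = (c \<cdot>\<^sub>m 1\<^sub>m k) $$ (i, j)" using \<open>U = 0\<^sub>m k k\<close> ij by simp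
  qed (use cT in auto)
  then show ?thesis by (rule that)
qed

section \<open>Characters\<close>

definition conj_transpose :: "complex mat \<Rightarrow> complex mat" where
  "conj_transpose A = mat (dim_col A) (dim_row A) (\<lambda>(i, j). cnj (A $$ (j, i)))"

lemma conj_transpose_carrier [simp]: "A \<in> carrier_mat m n \<Longrightarrow> conj_transpose A \<in> carrier_mat n m"
  by (auto simp: conj_transpose_def)

lemma conj_transpose_one [simp]: "conj_transpose (1\<^sub>m n) = 1\<^sub>m n"
  by (auto simp: conj_transpose_def intro!: eq_matI)

lemma conj_transpose_index:
  "A \<in> carrier_mat m n \<Longrightarrow> i < n \<Longrightarrow> j < m \<Longrightarrow> conj_transpose A $$ (i, j) = cnj (A $$ (j, i))"
  by (auto simp: conj_transpose_def)

lemma conj_transpose_mult: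
  assumes A: "A \<in> carrier_mat m n" and B: "B \<in> carrier_mat n l"
  shows "conj_transpose (A * B) = conj_transpose B * conj_transpose A"
proof (rule eq_matI)
  fix i j assume "i < dim_row (conj_transpose B * conj_transpose A)" "j < dim_col (conj_transpose B * conj_transpose A)"
  then have ij: "i < l" "j < m" using A B by (auto simp: conj_transpose_def)
  have "conj_transpose (A * B) $$ (i, j) = (\<Sum>t<n. cnj (A $$ (j, t)) * cnj (B $$ (t, i)))"
    using ij A B by (simp add: conj_transpose_index[of _ m l] index_mult_mat_sum[of _ m n _ l] del: index_mult_mat(1))
  also have "\<dots> = (\<Sum>t<n. conj_transpose B $$ (i, t) * conj_transpose A $$ (t, j))"
    using ij A B by (intro sum.cong) (auto simp: conj_transpose_index[of A m n] conj_transpose_index[of B n l])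
  also have "\<dots> = (conj_transpose B * conj_transpose A) $$ (i, j)"
    by (rule index_mult_mat_sum[symmetric, of _ l n _ m]) (use A B ij in auto)
  finally show "conj_transpose (A * B) $$ (i, j) = (conj_transpose B * conj_transpose A) $$ (i, j)" .
qed (use A B in \<open>auto simp: conj_transpose_def\<close>)

lemma mat_trace_conj_transpose: "A \<in> carrier_mat n n \<Longrightarrow> mat_trace (conj_transpose A) = cnj (mat_trace A)"
  by (auto simp: mat_trace_def conj_transpose_def)

text \<open>Inversion and conjugate transposition both reverse products. The result is the complex
  conjugate of the usual dual, and it is \<open>\<rho>\<close> itself when \<open>\<rho>\<close> is
  unitary.\<close>

lemma (in group) is_rep_contragredient:
  assumes \<rho>: "is_rep G n \<rho>"
  shows "is_rep G n (\<lambda>g. conj_transpose (\<rho> (inv g)))"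
  unfolding is_rep_def
proof (intro conjI ballI)
  note c = is_rep_carrier[OF \<rho>]
  show "conj_transpose (\<rho> (inv g)) \<in> carrier_mat n n" if "g \<in> carrier G" for g
    using c that by simp
  show "conj_transpose (\<rho> (inv \<one>)) = 1\<^sub>m n" using is_rep_one[OF \<rho>] by simp
  show "conj_transpose (\<rho> (inv (g \<otimes> h))) = conj_transpose (\<rho> (inv g)) * conj_transpose (\<rho> (inv h))"
    if "g \<in> carrier G" "h \<in> carrier G" for g h
    using that conj_transpose_mult[OF c c, of "inv h" "inv g"] by (simp add: inv_mult_group is_rep_mult[OF \<rho>])
qed

lemma (in group) mat_trace_eq_if_inverse:
  assumes \<sigma>: "is_rep G n \<sigma>" and \<tau>: "is_rep G k \<tau>" and T: "intertwiner G n \<sigma> k \<tau> T"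
    and S: "S \<in> carrier_mat k n" "T * S = 1\<^sub>m n" "S * T = 1\<^sub>m k" and g: "g \<in> carrier G"
  shows "mat_trace (\<sigma> g) = mat_trace (\<tau> g)"
proof -
  have cT: "T \<in> carrier_mat n k" and com: "\<sigma> g * T = T * \<tau> g" using T g by (auto simp: intertwiner_def)
  note cs = is_rep_carrier[OF \<sigma> g] and ct = is_rep_carrier[OF \<tau> g]
  have "\<sigma> g = \<sigma> g * (T * S)" using S cs by simp
  also have "\<dots> = T * (\<tau> g * S)"
    unfolding assoc_mult_mat[OF cs cT S(1), symmetric] com by (rule assoc_mult_mat[OF cT ct S(1)])
  finally have "mat_trace (\<sigma> g) = mat_trace (T * (\<tau> g * S))" by simp
  also have "\<dots> = mat_trace (\<tau> g * S * T)"
    by (rule mat_trace_comm[of _ n k]) (use cT ct S in auto)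
  also have "\<tau> g * S * T = \<tau> g" unfolding assoc_mult_mat[OF ct S(1) cT] using S ct by simp
  finally show ?thesis .
qed

text \<open>\<open>S = (\<Sum>g. conj_transpose (\<rho> g) * \<rho> g)\<close> is positive definite, hence an isomorphism from \<open>\<rho>\<close> to
  its contragredient.\<close>
lemma (in group) mat_trace_inv:
  assumes fin: "finite (carrier G)" and \<rho>: "is_rep G n \<rho>" and g: "g \<in> carrier G"
  shows "mat_trace (\<rho> (inv g)) = cnj (mat_trace (\<rho> g))"
proof -
  note c = is_rep_carrier[OF \<rho>]
  define S where "S = msum n n (\<lambda>g. conj_transpose (\<rho> (inv g)) * 1\<^sub>m n * \<rho> (inv g)) (carrier G)"
  have S: "S \<in> carrier_mat n n" by (simp add: S_def)
  have S_eq: "S = msum n n (\<lambda>g. conj_transpose (\<rho> (inv g)) * \<rho> (inv g)) (carrier G)"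
    unfolding S_def by (rule msum_cong) (simp add: right_mult_one_mat[OF conj_transpose_carrier[OF c]])
  have I: "intertwiner G n (\<lambda>g. conj_transpose (\<rho> (inv g))) n \<rho> S"
    unfolding S_def by (rule intertwiner_average[OF is_rep_contragredient[OF \<rho>] \<rho>]) simp
  have "det S \<noteq> 0"
  proof
    assume "det S = 0"
    then obtain v where v: "v \<in> carrier_vec n" "v \<noteq> 0\<^sub>v n" "S *\<^sub>v v = 0\<^sub>v n"
      using det_0_iff_vec_prod_zero_field[OF S] by auto
    \<comment> \<open>With \<open>v\<close> written as a one-column matrix, the only entry of
      \<open>conj_transpose V * (S * V)\<close> is the sum over the group of the squared norms of
      \<open>\<rho> (inv g) * V\<close>. It can vanish only if every one of these norms
      does.\<close>
    define V where "V = mat n 1 (\<lambda>(i, j). v $ i)"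
    have V: "V \<in> carrier_mat n 1" by (simp add: V_def)
    have cV: "conj_transpose V \<in> carrier_mat 1 n" by (rule conj_transpose_carrier[OF V])
    have "S * V = 0\<^sub>m n 1"
    proof (rule eq_matI)
      fix i j assume "i < dim_row (0\<^sub>m n 1 :: complex mat)" "j < dim_col (0\<^sub>m n 1 :: complex mat)"
      then have ij: "i < n" "j = 0" by auto
      have "col V 0 = v" using v by (auto simp: V_def intro!: eq_vecI)
      then have "(S * V) $$ (i, j) = (S *\<^sub>v v) $ i" using ij S V by simp
      then show "(S * V) $$ (i, j) = 0\<^sub>m n 1 $$ (i, j)" using ij v(3) by simp
    qed (use S V in auto)
    then have z: "conj_transpose V * (S * V) = 0\<^sub>m 1 1" using cV by simp
    have cr: "conj_transpose (\<rho> (inv g)) * \<rho> (inv g) \<in> carrier_mat n n" if "g \<in> carrier G" for g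
      by (intro mult_carrier_mat[of _ n n] conj_transpose_carrier c inv_closed that)
    have "conj_transpose V * (S * V)
        = msum 1 1 (\<lambda>g. conj_transpose V * (conj_transpose (\<rho> (inv g)) * \<rho> (inv g) * V)) (carrier G)"
    proof -
      have "S * V = msum n 1 (\<lambda>g. conj_transpose (\<rho> (inv g)) * \<rho> (inv g) * V) (carrier G)"
        unfolding S_eq by (rule msum_mult[OF V cr])
      then show ?thesis using mult_msum[OF cV mult_carrier_mat[OF cr V], of "carrier G"] by simp
    qed
    also have "\<dots> = msum 1 1 (\<lambda>g. conj_transpose (\<rho> (inv g) * V) * (\<rho> (inv g) * V)) (carrier G)"
    proof (rule msum_cong)
      fix g assume "g \<in> carrier G"
      then have r: "\<rho> (inv g) \<in> carrier_mat n n" using c by simp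
      note r' = conj_transpose_carrier[OF r]
      show "conj_transpose V * (conj_transpose (\<rho> (inv g)) * \<rho> (inv g) * V)
          = conj_transpose (\<rho> (inv g) * V) * (\<rho> (inv g) * V)"
        unfolding conj_transpose_mult[OF r V] assoc_mult_mat[OF r' r V]
        by (rule assoc_mult_mat[symmetric, OF cV r' mult_carrier_mat[OF r V]])
    qed
    finally have eq: "conj_transpose V * (S * V)
        = msum 1 1 (\<lambda>g. conj_transpose (\<rho> (inv g) * V) * (\<rho> (inv g) * V)) (carrier G)" .
    have "(\<Sum>g\<in>carrier G. (conj_transpose (\<rho> (inv g) * V) * (\<rho> (inv g) * V)) $$ (0, 0))
        = msum 1 1 (\<lambda>g. conj_transpose (\<rho> (inv g) * V) * (\<rho> (inv g) * V)) (carrier G) $$ (0, 0)"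
      by (rule msum_index[symmetric]) simp_all
    also have "\<dots> = 0" unfolding eq[symmetric] z by simp
    finally have "(\<Sum>g\<in>carrier G. (conj_transpose (\<rho> (inv g) * V) * (\<rho> (inv g) * V)) $$ (0, 0)) = 0" .
    moreover have "(conj_transpose X * X) $$ (0, 0) = of_real (\<Sum>i<n. (cmod (X $$ (i, 0)))\<^sup>2)"
      if X: "X \<in> carrier_mat n 1" for X
    proof -
      have "(conj_transpose X * X) $$ (0, 0) = (\<Sum>i<n. conj_transpose X $$ (0, i) * X $$ (i, 0))"
        by (rule index_mult_mat_sum[OF conj_transpose_carrier[OF X] X]) simp_all
      also have "\<dots> = (\<Sum>i<n. of_real ((cmod (X $$ (i, 0)))\<^sup>2))"
        by (rule sum.cong) (auto simp: conj_transpose_index[OF X] complex_norm_square mult.commute simp del: of_real_power)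
      finally show ?thesis by simp
    qed
    moreover have "\<rho> (inv g) * V \<in> carrier_mat n 1" if "g \<in> carrier G" for g
      using mult_carrier_mat[OF c V] that by simp
    ultimately have "(\<Sum>g\<in>carrier G. complex_of_real (\<Sum>i<n. (cmod ((\<rho> (inv g) * V) $$ (i, 0)))\<^sup>2)) = 0"
      by simp
    then have "complex_of_real (\<Sum>g\<in>carrier G. \<Sum>i<n. (cmod ((\<rho> (inv g) * V) $$ (i, 0)))\<^sup>2) = 0"
      by (simp only: of_real_sum)
    then have "(\<Sum>g\<in>carrier G. \<Sum>i<n. (cmod ((\<rho> (inv g) * V) $$ (i, 0)))\<^sup>2) = 0"
      by (simp only: of_real_eq_0_iff)
    then have "\<forall>g\<in>carrier G. (\<Sum>i<n. (cmod ((\<rho> (inv g) * V) $$ (i, 0)))\<^sup>2) = 0"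
      by (subst (asm) sum_nonneg_eq_0_iff[OF fin]) (auto intro: sum_nonneg)
    \<comment> \<open>The summand at the identity is the squared norm of \<open>v\<close>
      itself.\<close>
    then have "(\<Sum>i<n. (cmod ((\<rho> (inv \<one>) * V) $$ (i, 0)))\<^sup>2) = 0" by blast
    then have "(\<Sum>i<n. (cmod (V $$ (i, 0)))\<^sup>2) = 0"
      using is_rep_one[OF \<rho>] left_mult_one_mat[OF V] by simp
    then have "\<forall>i\<in>{..<n}. (cmod (V $$ (i, 0)))\<^sup>2 = 0"
      by (subst (asm) sum_nonneg_eq_0_iff) auto
    then have "v = 0\<^sub>v n" using v(1) by (intro eq_vecI) (auto simp: V_def)
    with v(2) show False ..
  qed
  then obtain S' where "S' \<in> carrier_mat n n" "S * S' = 1\<^sub>m n" "S' * S = 1\<^sub>m n"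
    using det_non_zero_imp_unit[OF S, of n] unfolding Units_def ring_mat_def by auto
  from mat_trace_eq_if_inverse[OF is_rep_contragredient[OF \<rho>] \<rho> I this g]
  have "cnj (mat_trace (\<rho> (inv g))) = mat_trace (\<rho> g)"
    using mat_trace_conj_transpose[OF c, of "inv g"] g by simp
  then show ?thesis by (metis complex_cnj_cnj)
qed

section \<open>Orthogonality of irreducible characters\<close>

lemma mult_unit_mat_mult_index:
  fixes A B :: "'a::comm_semiring_1 mat"
  assumes A: "A \<in> carrier_mat m n" and B: "B \<in> carrier_mat k l"
    and "i < m" "a < n" "b < k" "j < l"
  shows "(A * mat n k (\<lambda>(s, t). if s = a \<and> t = b then 1 else 0) * B) $$ (i, j) = A $$ (i, a) * B $$ (b, j)"
proof -
  let ?X = "mat n k (\<lambda>(s, t). if s = a \<and> t = b then 1 else 0 :: 'a)"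
  have AX: "(A * ?X) $$ (i, t) = (if t = b then A $$ (i, a) else 0)" if "t < k" for t
  proof -
    have "(A * ?X) $$ (i, t) = (\<Sum>s<n. A $$ (i, s) * (if s = a \<and> t = b then 1 else 0))"
      using assms that by (auto simp: scalar_prod_def atLeast0LessThan intro!: sum.cong)
    also have "\<dots> = (\<Sum>s<n. if s = a then (if t = b then A $$ (i, a) else 0) else 0)"
      by (rule sum.cong) auto
    finally show ?thesis using assms by simp
  qed
  have "(A * ?X * B) $$ (i, j) = (\<Sum>t<k. (A * ?X) $$ (i, t) * B $$ (t, j))"
    by (rule index_mult_mat_sum[of _ m k _ l]) (use assms in auto)
  also have "\<dots> = (\<Sum>t<k. if t = b then A $$ (i, a) * B $$ (b, j) else 0)"
    by (rule sum.cong) (auto simp: AX)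
  finally show ?thesis using assms by simp
qed

text \<open>The product of a diagonal entry \<open>(a, a)\<close> of \<open>\<sigma> g\<close> and a
  diagonal entry \<open>(b, b)\<close> of \<open>\<tau> (inv g)\<close> is the entry
  \<open>(a, b)\<close> of \<open>\<sigma> g * X * \<tau> (inv g)\<close> with \<open>X\<close> the
  matrix unit at \<open>(a, b)\<close>. The character sum is thus assembled from averages, to which
  Schur's lemma applies.\<close>

lemma (in group) char_orthogonality_aux:
  assumes \<sigma>: "is_rep G n \<sigma>" and \<tau>: "is_rep G k \<tau>"
  shows "(\<Sum>g\<in>carrier G. mat_trace (\<sigma> g) * mat_trace (\<tau> (inv g))) =
    (\<Sum>a<n. \<Sum>b<k. msum n k (\<lambda>g. \<sigma> g * mat n k (\<lambda>(s, t). if s = a \<and> t = b then 1 else 0) * \<tau> (inv g)) (carrier G) $$ (a, b))"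
proof -
  note cs = is_rep_carrier[OF \<sigma>] and ct = is_rep_carrier[OF \<tau>]
  have "mat_trace (\<sigma> g) * mat_trace (\<tau> (inv g)) = (\<Sum>a<n. \<Sum>b<k. \<sigma> g $$ (a, a) * \<tau> (inv g) $$ (b, b))"
    if "g \<in> carrier G" for g
    using cs[OF that] ct[OF inv_closed[OF that]] by (auto simp: mat_trace_def sum_product)
  then have "(\<Sum>g\<in>carrier G. mat_trace (\<sigma> g) * mat_trace (\<tau> (inv g)))
      = (\<Sum>g\<in>carrier G. \<Sum>a<n. \<Sum>b<k. \<sigma> g $$ (a, a) * \<tau> (inv g) $$ (b, b))" by (rule sum.cong[OF refl])
  also have "\<dots> = (\<Sum>a<n. \<Sum>b<k. \<Sum>g\<in>carrier G. \<sigma> g $$ (a, a) * \<tau> (inv g) $$ (b, b))"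
    by (subst sum.swap, rule sum.cong[OF refl], rule sum.swap)
  also have "\<dots> = (\<Sum>a<n. \<Sum>b<k. msum n k (\<lambda>g. \<sigma> g * mat n k (\<lambda>(s, t). if s = a \<and> t = b then 1 else 0) * \<tau> (inv g)) (carrier G) $$ (a, b))"
  proof (intro sum.cong refl)
    fix a b assume "a \<in> {..<n}" "b \<in> {..<k}"
    then have ab: "a < n" "b < k" by auto
    show "(\<Sum>g\<in>carrier G. \<sigma> g $$ (a, a) * \<tau> (inv g) $$ (b, b)) =
        msum n k (\<lambda>g. \<sigma> g * mat n k (\<lambda>(s, t). if s = a \<and> t = b then 1 else 0) * \<tau> (inv g)) (carrier G) $$ (a, b)"
      unfolding msum_index[OF ab]
      by (rule sum.cong[OF refl], rule mult_unit_mat_mult_index[symmetric, of _ n n _ k k])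
        (use ab cs ct in auto)
  qed
  finally show ?thesis .
qed

lemma (in group) char_orthogonal:
  assumes \<sigma>: "is_rep G n \<sigma>" and \<tau>: "is_rep G k \<tau>"
    and "\<And>T. intertwiner G n \<sigma> k \<tau> T \<Longrightarrow> T = 0\<^sub>m n k"
  shows "(\<Sum>g\<in>carrier G. mat_trace (\<sigma> g) * mat_trace (\<tau> (inv g))) = 0"
  unfolding char_orthogonality_aux[OF \<sigma> \<tau>]
  by (intro sum.neutral ballI) (simp add: assms(3)[OF intertwiner_average[OF \<sigma> \<tau>]])

text \<open>Each averaged matrix unit is a scalar \<open>c\<close> by Schur's lemma. Taking traces
  gives \<open>k * c = card (carrier G)\<close> for \<open>a = b\<close> and \<open>c = 0\<close>
  otherwise, and the \<open>k\<close> diagonal units together contribute the group order.\<close>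

lemma (in group) char_norm:
  assumes \<tau>: "irr_rep G k \<tau>"
  shows "(\<Sum>g\<in>carrier G. mat_trace (\<tau> g) * mat_trace (\<tau> (inv g))) = of_nat (card (carrier G))"
proof -
  have \<tau>r: "is_rep G k \<tau>" and k: "k > 0" using \<tau> by (auto simp: irr_rep_def)
  note ct = is_rep_carrier[OF \<tau>r]
  let ?X = "\<lambda>a b. mat k k (\<lambda>(s, t). if s = a \<and> t = b then 1 else 0) :: complex mat"
  let ?T = "\<lambda>a b. msum k k (\<lambda>g. \<tau> g * ?X a b * \<tau> (inv g)) (carrier G)"
  let ?N = "of_nat (card (carrier G)) :: complex"
  have "?T a b $$ (a, b) = (if a = b then ?N / of_nat k else 0)" if ab: "a < k" "b < k" for a b
  proof -
    obtain c where c: "?T a b = c \<cdot>\<^sub>m 1\<^sub>m k"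
      using schur_scalar[OF \<tau> intertwiner_average[OF \<tau>r \<tau>r, of "?X a b"]] by auto
    have tr: "mat_trace (\<tau> g * ?X a b * \<tau> (inv g)) = (if a = b then 1 else 0)" if g: "g \<in> carrier G" for g
    proof -
      have "mat_trace (\<tau> g * ?X a b * \<tau> (inv g)) = mat_trace (\<tau> (inv g) * (\<tau> g * ?X a b))"
        by (rule mat_trace_comm[of _ k k]) (auto intro!: mult_carrier_mat[of _ k k] ct g)
      also have "\<tau> (inv g) * (\<tau> g * ?X a b) = \<tau> (inv g) * \<tau> g * ?X a b"
        by (rule assoc_mult_mat[symmetric, of _ k k _ k _ k]) (use ct g in auto)
      also have "\<dots> = ?X a b" using is_rep_inv(2)[OF \<tau>r g] by simp
      also have "mat_trace (?X a b) = (\<Sum>i<k. if i = a then if a = b then 1 else 0 else 0)"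
        by (auto simp: mat_trace_def intro!: sum.cong)
      finally show ?thesis using ab by simp
    qed
    have cc: "\<tau> g * ?X a b * \<tau> (inv g) \<in> carrier_mat k k" if "g \<in> carrier G" for g
      by (intro mult_carrier_mat[of _ k k] ct that inv_closed) simp
    have "of_nat k * c = mat_trace (?T a b)" unfolding c by (simp add: mat_trace_def)
    also have "\<dots> = (\<Sum>g\<in>carrier G. mat_trace (\<tau> g * ?X a b * \<tau> (inv g)))" by (rule mat_trace_msum[OF cc])
    also have "\<dots> = (if a = b then ?N else 0)" using tr by simp
    finally have "c = (if a = b then ?N / of_nat k else 0)" using k by (auto simp: field_simps split: if_splits)
    then show ?thesis unfolding c using ab by simp
  qed
  then have "(\<Sum>a<k. \<Sum>b<k. ?T a b $$ (a, b)) = (\<Sum>a<k. \<Sum>b<k. if a = b then ?N / of_nat k else 0)"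
    by (intro sum.cong) auto
  also have "\<dots> = ?N" using k by simp
  finally show ?thesis unfolding char_orthogonality_aux[OF \<tau>r \<tau>r] .
qed

section \<open>Multiplicities and endomorphisms\<close>

text \<open>Insert the identity as the sum of the projectors \<open>J * P\<close>. Since
  \<open>\<sigma> g * J = J * \<tau> g\<close>, cyclicity of the trace and \<open>P * J = 1\<close>
  leave the trace of \<open>\<tau> g\<close>.\<close>

lemma decomposes_char:
  assumes \<sigma>: "is_rep G n \<sigma>" and d: "decomposes G n \<sigma> r d" and g: "g \<in> carrier G"
  shows "mat_trace (\<sigma> g) = (\<Sum>i<r. mat_trace (fst (snd (d i)) g))"
proof -
  have cs: "\<sigma> g \<in> carrier_mat n n" by (rule is_rep_carrier[OF \<sigma> g])
  have di: "constituent G n \<sigma> (d i)" if "i < r" for i using d that by (simp add: decomposes_def)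
  have pc: "projector (d i) \<in> carrier_mat n n" if "i \<in> {..<r}" for i
    using projector_carrier[OF di] that by simp
  have "\<sigma> g = \<sigma> g * msum n n (\<lambda>i. projector (d i)) {..<r}"
    using d cs by (simp add: decomposes_def)
  also have "\<dots> = msum n n (\<lambda>i. \<sigma> g * projector (d i)) {..<r}"
    by (rule mult_msum[OF cs pc])
  finally have "mat_trace (\<sigma> g) = mat_trace (msum n n (\<lambda>i. \<sigma> g * projector (d i)) {..<r})" by simp
  also have "\<dots> = (\<Sum>i<r. mat_trace (\<sigma> g * projector (d i)))"
    by (rule mat_trace_msum[OF mult_carrier_mat[OF cs pc]])
  also have "\<dots> = (\<Sum>i<r. mat_trace (fst (snd (d i)) g))"
  proof (rule sum.cong[OF refl])
    fix i assume "i \<in> {..<r}"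
    then have c: "constituent G n \<sigma> (d i)" using di by simp
    obtain k \<tau> J P where di: "d i = (k, \<tau>, J, P)" by (cases "d i")
    have s: "J \<in> carrier_mat n k" "P \<in> carrier_mat k n" "P * J = 1\<^sub>m k" "\<sigma> g * J = J * \<tau> g" "\<tau> g \<in> carrier_mat k k"
      using c g by (auto simp: di constituent_def split_rep_def intertwiner_def is_rep_carrier)
    have "\<sigma> g * (J * P) = J * \<tau> g * P"
      unfolding assoc_mult_mat[OF cs s(1,2), symmetric] s(4) by simp
    then have "mat_trace (\<sigma> g * projector (d i)) = mat_trace (J * \<tau> g * P)"
      by (simp add: di projector_def)
    also have "\<dots> = mat_trace (P * (J * \<tau> g))" by (rule mat_trace_comm[of _ n k]) (use s in auto)
    also have "P * (J * \<tau> g) = \<tau> g" unfolding assoc_mult_mat[OF s(2,1,5), symmetric] s(3) using s(5) by simp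
    finally show "mat_trace (\<sigma> g * projector (d i)) = mat_trace (fst (snd (d i)) g)" by (simp add: di)
  qed
  finally show ?thesis .
qed

text \<open>Completeness of the projectors means that a matrix is determined by its products with
  the embeddings \<open>J\<close>. This allows matrix identities to be tested one constituent at a
  time.\<close>

lemma mult_eq_if_projectors:
  assumes d: "decomposes G n \<sigma> r d" and A: "A \<in> carrier_mat n n" and B: "B \<in> carrier_mat n n"
    and eq: "\<And>i k \<tau> J P. i < r \<Longrightarrow> d i = (k, \<tau>, J, P) \<Longrightarrow> A * J = B * J"
  shows "A = B"
proof -
  have di: "constituent G n \<sigma> (d i)" if "i < r" for i using d that by (simp add: decomposes_def)
  have pc: "projector (d i) \<in> carrier_mat n n" if "i \<in> {..<r}" for i
    using projector_carrier[OF di] that by simp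
  have *: "M = msum n n (\<lambda>i. M * projector (d i)) {..<r}" if M: "M \<in> carrier_mat n n" for M
  proof -
    have "M = M * msum n n (\<lambda>i. projector (d i)) {..<r}" using d M by (simp add: decomposes_def)
    also have "\<dots> = msum n n (\<lambda>i. M * projector (d i)) {..<r}" by (rule mult_msum[OF M pc])
    finally show ?thesis .
  qed
  have "A * projector (d i) = B * projector (d i)" if "i \<in> {..<r}" for i
  proof -
    from that have i: "i < r" by simp
    obtain k \<tau> J P where dd: "d i = (k, \<tau>, J, P)" by (cases "d i")
    have s: "J \<in> carrier_mat n k" "P \<in> carrier_mat k n"
      using di[OF i] by (auto simp: dd constituent_def split_rep_def intertwiner_def)
    have "A * (J * P) = B * (J * P)"
      unfolding assoc_mult_mat[OF A s, symmetric] assoc_mult_mat[OF B s, symmetric] eq[OF i dd] ..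
    then show ?thesis by (simp add: dd projector_def)
  qed
  then have "msum n n (\<lambda>i. A * projector (d i)) {..<r} = msum n n (\<lambda>i. B * projector (d i)) {..<r}"
    by (rule msum_cong)
  then show ?thesis using *[OF A] *[OF B] by simp
qed

text \<open>For \<open>i\<close> different from \<open>m\<close>, the block of \<open>A\<close> from
  constituent \<open>m\<close> to constituent \<open>i\<close> is an intertwiner and vanishes by the
  hypothesis on homomorphisms; the block from \<open>m\<close> to itself is a scalar by Schur's
  lemma. Summing the blocks recovers \<open>A * J\<close>.\<close>

lemma endomorphism_on_constituent:
  assumes \<sigma>: "is_rep G n \<sigma>" and d: "decomposes G n \<sigma> r d"
    and hom: "\<And>i j k \<tau> J P k' \<tau>' J' P' T. i < r \<Longrightarrow> j < r \<Longrightarrow> i \<noteq> j \<Longrightarrow> d i = (k, \<tau>, J, P) \<Longrightarrow> d j = (k', \<tau>', J', P') \<Longrightarrow>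
      intertwiner G k \<tau> k' \<tau>' T \<Longrightarrow> T = 0\<^sub>m k k'"
    and A: "intertwiner G n \<sigma> n \<sigma> A" and m: "m < r" and dm: "d m = (k, \<tau>, J, P)"
  obtains c where "A * J = c \<cdot>\<^sub>m J"
proof -
  have di: "constituent G n \<sigma> (d i)" if "i < r" for i using d that by (simp add: decomposes_def)
  have pc: "projector (d i) \<in> carrier_mat n n" if "i \<in> {..<r}" for i
    using projector_carrier[OF di] that by simp
  have cA: "A \<in> carrier_mat n n" using A by (simp add: intertwiner_def)
  have s: "J \<in> carrier_mat n k" "P \<in> carrier_mat k n" "irr_rep G k \<tau>" "is_rep G k \<tau>"
    "intertwiner G n \<sigma> k \<tau> J" "intertwiner G k \<tau> n \<sigma> P"
    using di[OF m] by (auto simp: dm constituent_def split_rep_def intertwiner_def)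
  have AJ: "intertwiner G n \<sigma> k \<tau> (A * J)" by (rule intertwiner_mult[OF \<sigma> \<sigma> s(4) A s(5)])
  have cAJ: "A * J \<in> carrier_mat n k" using cA s by simp
  obtain c where c: "P * (A * J) = c \<cdot>\<^sub>m 1\<^sub>m k"
    by (rule schur_scalar[OF s(3) intertwiner_mult[OF s(4) \<sigma> s(4) s(6) AJ]])
  have p: "projector (d i) * (A * J) = (if i = m then c \<cdot>\<^sub>m J else 0\<^sub>m n k)" if i: "i < r" for i
  proof -
    obtain k' \<tau>' J' P' where dd: "d i = (k', \<tau>', J', P')" by (cases "d i")
    have t: "J' \<in> carrier_mat n k'" "P' \<in> carrier_mat k' n" "is_rep G k' \<tau>'" "intertwiner G k' \<tau>' n \<sigma> P'"
      using di[OF i] by (auto simp: dd constituent_def split_rep_def intertwiner_def)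
    have "projector (d i) * (A * J) = J' * (P' * (A * J))"
      unfolding dd projector_def using assoc_mult_mat[OF t(1,2) cAJ] by simp
    also have "\<dots> = (if i = m then c \<cdot>\<^sub>m J else 0\<^sub>m n k)"
    proof (cases "i = m")
      case True
      then have "J' = J" "P' = P" using dd dm by auto
      then show ?thesis using c True s by (simp add: mult_smult_distrib[of _ n k _ k])
    next
      case False
      have "P' * (A * J) = 0\<^sub>m k' k"
        by (rule hom[OF i m False dd dm intertwiner_mult[OF t(3) \<sigma> s(4) t(4) AJ]])
      then show ?thesis using False t by simp
    qed
    finally show ?thesis .
  qed
  have "A * J = msum n n (\<lambda>i. projector (d i)) {..<r} * (A * J)"
    using d left_mult_one_mat[OF cAJ] by (simp add: decomposes_def)
  also have "\<dots> = msum n k (\<lambda>i. projector (d i) * (A * J)) {..<r}"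
    by (rule msum_mult[OF cAJ pc])
  also have "\<dots> = msum n k (\<lambda>i. if i = m then c \<cdot>\<^sub>m J else 0\<^sub>m n k) {..<r}"
    by (rule msum_cong) (simp add: p)
  also have "\<dots> = c \<cdot>\<^sub>m J"
  proof (rule eq_matI)
    fix i j assume "i < dim_row (c \<cdot>\<^sub>m J)" "j < dim_col (c \<cdot>\<^sub>m J)"
    then have ij: "i < n" "j < k" using s by auto
    have "msum n k (\<lambda>i. if i = m then c \<cdot>\<^sub>m J else 0\<^sub>m n k) {..<r} $$ (i, j)
        = (\<Sum>l<r. if l = m then (c \<cdot>\<^sub>m J) $$ (i, j) else 0)"
      unfolding msum_index[OF ij] by (rule sum.cong) (use ij in auto)
    then show "msum n k (\<lambda>i. if i = m then c \<cdot>\<^sub>m J else 0\<^sub>m n k) {..<r} $$ (i, j) = (c \<cdot>\<^sub>m J) $$ (i, j)"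
      using m by simp
  qed (use s in \<open>auto simp: msum_def\<close>)
  finally show ?thesis by (rule that)
qed

text \<open>If no two constituents were isomorphic, \<open>A\<close> and \<open>B\<close> would act
  on each of them by scalars and would commute. So some constituent \<open>j\<close> has an
  isomorphic partner, and by orthogonality the character sum counts the set \<open>I\<close> of all
  indices isomorphic to \<open>j\<close>.\<close>

lemma (in group) multiplicity_ge_2:
  assumes fin: "finite (carrier G)" and \<sigma>: "is_rep G n \<sigma>"
    and A: "intertwiner G n \<sigma> n \<sigma> A" and B: "intertwiner G n \<sigma> n \<sigma> B" and ne: "A * B \<noteq> B * A"
  obtains k \<tau> N where "irr_rep G k \<tau>" "N \<ge> 2"
    "(\<Sum>g\<in>carrier G. mat_trace (\<sigma> g) * mat_trace (\<tau> (inv g))) = of_nat N * of_nat (card (carrier G))"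
proof -
  obtain r d where d: "decomposes G n \<sigma> r d" using ex_decomposition[OF fin \<sigma>] by blast
  have di: "constituent G n \<sigma> (d i)" if "i < r" for i using d that by (simp add: decomposes_def)
  have cA: "A \<in> carrier_mat n n" and cB: "B \<in> carrier_mat n n" using A B by (auto simp: intertwiner_def)
  define dim where "dim i = fst (d i)" for i
  define rep where "rep i = fst (snd (d i))" for i
  have irr: "irr_rep G (dim i) (rep i)" if "i < r" for i
    using di[OF that] by (auto simp: constituent_def dim_def rep_def split: prod.splits)
  define iso where "iso i j \<longleftrightarrow> (\<exists>T. intertwiner G (dim i) (rep i) (dim j) (rep j) T \<and> T \<noteq> 0\<^sub>m (dim i) (dim j))" for i j
  have "\<exists>i j. i < r \<and> j < r \<and> i \<noteq> j \<and> iso i j"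
  proof (rule ccontr)
    assume no: "\<nexists>i j. i < r \<and> j < r \<and> i \<noteq> j \<and> iso i j"
    have hom: "T = 0\<^sub>m k k'"
      if "i < r" "j < r" "i \<noteq> j" "d i = (k, \<tau>, J, P)" "d j = (k', \<tau>', J', P')" "intertwiner G k \<tau> k' \<tau>' T"
      for i j k \<tau> J P k' \<tau>' J' P' T
      using no that unfolding iso_def dim_def rep_def by (metis fst_conv snd_conv)
    have "A * B = B * A"
    proof (rule mult_eq_if_projectors[OF d])
      fix i k \<tau> J P assume i: "i < r" and dd: "d i = (k, \<tau>, J, P)"
      have J: "J \<in> carrier_mat n k"
        using di[OF i] by (auto simp: dd constituent_def split_rep_def intertwiner_def)
      obtain a where a: "A * J = a \<cdot>\<^sub>m J" by (rule endomorphism_on_constituent[OF \<sigma> d hom A i dd])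
      obtain b where b: "B * J = b \<cdot>\<^sub>m J" by (rule endomorphism_on_constituent[OF \<sigma> d hom B i dd])
      show "A * B * J = B * A * J"
        unfolding assoc_mult_mat[OF cA cB J] assoc_mult_mat[OF cB cA J] a b
          mult_smult_distrib[OF cA J] mult_smult_distrib[OF cB J]
        by (auto simp: mult_ac intro!: eq_matI)
    qed (use cA cB in auto)
    with ne show False ..
  qed
  then obtain i j where ij: "i < r" "j < r" "i \<noteq> j" "iso i j" by blast
  let ?c = "of_nat (card (carrier G)) :: complex"
  define I where "I = {l. l < r \<and> iso l j}"
  have iso_tr: "mat_trace (rep l g) = mat_trace (rep j g)" if l: "l < r" "iso l j" and g: "g \<in> carrier G" for l g
  proof -
    obtain T where T: "intertwiner G (dim l) (rep l) (dim j) (rep j) T" "T \<noteq> 0\<^sub>m (dim l) (dim j)"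
      using l by (auto simp: iso_def)
    obtain S where "S \<in> carrier_mat (dim j) (dim l)" "T * S = 1\<^sub>m (dim l)" "S * T = 1\<^sub>m (dim j)"
      by (rule schur_inverse[OF irr[OF l(1)] irr[OF ij(2)] T])
    from mat_trace_eq_if_inverse[OF irr_rep_is_rep[OF irr[OF l(1)]] irr_rep_is_rep[OF irr[OF ij(2)]] T(1) this g]
    show ?thesis .
  qed
  have "(\<Sum>g\<in>carrier G. mat_trace (\<sigma> g) * mat_trace (rep j (inv g)))
      = (\<Sum>g\<in>carrier G. \<Sum>l<r. mat_trace (rep l g) * mat_trace (rep j (inv g)))"
    by (rule sum.cong) (auto simp: decomposes_char[OF \<sigma> d] rep_def sum_distrib_right)
  also have "\<dots> = (\<Sum>l<r. \<Sum>g\<in>carrier G. mat_trace (rep l g) * mat_trace (rep j (inv g)))"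
    by (rule sum.swap)
  also have "\<dots> = (\<Sum>l<r. if l \<in> I then ?c else 0)"
  proof (rule sum.cong[OF refl])
    fix l assume "l \<in> {..<r}"
    then have l: "l < r" by simp
    show "(\<Sum>g\<in>carrier G. mat_trace (rep l g) * mat_trace (rep j (inv g))) = (if l \<in> I then ?c else 0)"
    proof (cases "iso l j")
      case True
      then have "(\<Sum>g\<in>carrier G. mat_trace (rep l g) * mat_trace (rep j (inv g)))
        = (\<Sum>g\<in>carrier G. mat_trace (rep j g) * mat_trace (rep j (inv g)))"
        by (intro sum.cong) (auto simp: iso_tr[OF l])
      then show ?thesis using True l char_norm[OF irr[OF ij(2)]] by (simp add: I_def)
    next
      case False
      have "(\<Sum>g\<in>carrier G. mat_trace (rep l g) * mat_trace (rep j (inv g))) = 0"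
        by (rule char_orthogonal[OF irr_rep_is_rep[OF irr[OF l]] irr_rep_is_rep[OF irr[OF ij(2)]]])
          (use False in \<open>auto simp: iso_def\<close>)
      then show ?thesis using False by (simp add: I_def)
    qed
  qed
  also have "\<dots> = of_nat (card I) * ?c"
  proof -
    have "{..<r} \<inter> I = I" by (auto simp: I_def)
    then show ?thesis by (simp flip: sum.inter_restrict)
  qed
  finally have sum: "(\<Sum>g\<in>carrier G. mat_trace (\<sigma> g) * mat_trace (rep j (inv g))) = of_nat (card I) * ?c" .
  \<comment> \<open>If only the zero matrix intertwined \<open>rep j\<close> with itself,
    orthogonality would make the sum computed in \<open>char_norm\<close> zero. Hence
    \<open>j\<close> counts itself and \<open>I\<close> has at least two elements.\<close>
  have "iso j j"
  proof -
    have "?c \<noteq> 0" using fin by auto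
    then have "\<not> (\<forall>T. intertwiner G (dim j) (rep j) (dim j) (rep j) T \<longrightarrow> T = 0\<^sub>m (dim j) (dim j))"
      using char_orthogonal[OF irr_rep_is_rep[OF irr[OF ij(2)]] irr_rep_is_rep[OF irr[OF ij(2)]]]
        char_norm[OF irr[OF ij(2)]] by auto
    then show ?thesis by (auto simp: iso_def)
  qed
  then have "{i, j} \<subseteq> I" using ij by (auto simp: I_def)
  moreover have "finite I" by (simp add: I_def)
  ultimately have "card {i, j} \<le> card I" by (rule card_mono[rotated])
  then have "card I \<ge> 2" using ij(3) by simp
  with irr[OF ij(2)] sum that show ?thesis by blast
qed

section \<open>Strong Gelfand pairs\<close>

text \<open>As a trace, \<open>\<chi>\<close> is invariant under conjugation, so every
  \<open>x\<close> in the definition of \<open>induced\<close> contributes the same sum over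
  \<open>H\<close>. The resulting factor \<open>card (carrier G)\<close> cancels the normalization
  of \<open>char_inner\<close>.\<close>

lemma (in group) frobenius_reciprocity:
  assumes fin: "finite (carrier G)" and H: "subgroup H G" and \<rho>: "is_rep G n \<rho>"
    and \<chi>: "\<And>g. g \<in> carrier G \<Longrightarrow> \<chi> g = mat_trace (\<rho> g)"
  shows "char_inner G (induced G H \<psi>) \<chi> = (\<Sum>h\<in>H. \<psi> h * cnj (\<chi> h)) / of_nat (card H)"
proof -
  interpret H: subgroup H G by (fact H)
  note c = is_rep_carrier[OF \<rho>]
  have conj: "\<chi> (inv x \<otimes> y \<otimes> x) = \<chi> y" if x: "x \<in> carrier G" and y: "y \<in> carrier G" for x y
  proof -
    have "\<chi> (inv x \<otimes> y \<otimes> x) = mat_trace (\<rho> (inv x \<otimes> y) * \<rho> x)"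
      using x y by (simp add: \<chi> is_rep_mult[OF \<rho>])
    also have "\<dots> = mat_trace (\<rho> x * \<rho> (inv x \<otimes> y))"
      by (rule mat_trace_comm[of _ n n]) (use x y in \<open>auto intro: c\<close>)
    also have "\<rho> x * \<rho> (inv x \<otimes> y) = \<rho> (x \<otimes> (inv x \<otimes> y))"
      using x y by (simp add: is_rep_mult[OF \<rho>])
    also have "x \<otimes> (inv x \<otimes> y) = y" using x y by (simp flip: m_assoc)
    finally show ?thesis using y by (simp add: \<chi>)
  qed
  let ?f = "\<lambda>y. if y \<in> H then \<psi> y else 0"
  have inner: "(\<Sum>g\<in>carrier G. ?f (x \<otimes> g \<otimes> inv x) * cnj (\<chi> g)) = (\<Sum>h\<in>H. \<psi> h * cnj (\<chi> h))"
    if x: "x \<in> carrier G" for x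
  proof -
    have "(\<Sum>g\<in>carrier G. ?f (x \<otimes> g \<otimes> inv x) * cnj (\<chi> g)) = (\<Sum>y\<in>carrier G. ?f y * cnj (\<chi> y))"
    proof (rule sum.reindex_bij_witness[where j = "\<lambda>g. x \<otimes> g \<otimes> inv x" and i = "\<lambda>y. inv x \<otimes> y \<otimes> x"])
      fix g assume g: "g \<in> carrier G"
      show 1: "inv x \<otimes> (x \<otimes> g \<otimes> inv x) \<otimes> x = g" using x g by (simp add: m_assoc) (simp flip: m_assoc)
      show "x \<otimes> g \<otimes> inv x \<in> carrier G" using x g by simp
      show "?f (x \<otimes> g \<otimes> inv x) * cnj (\<chi> (x \<otimes> g \<otimes> inv x)) = ?f (x \<otimes> g \<otimes> inv x) * cnj (\<chi> g)"
        using conj[OF x, of "x \<otimes> g \<otimes> inv x"] x g by (simp add: 1)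
    next
      fix y assume y: "y \<in> carrier G"
      show "x \<otimes> (inv x \<otimes> y \<otimes> x) \<otimes> inv x = y" using x y by (simp add: m_assoc) (simp flip: m_assoc)
      show "inv x \<otimes> y \<otimes> x \<in> carrier G" using x y by simp
    qed
    also have "\<dots> = (\<Sum>h\<in>H. \<psi> h * cnj (\<chi> h))"
      by (rule sum.mono_neutral_cong_right) (use fin in auto)
    finally show ?thesis .
  qed
  let ?N = "of_nat (card (carrier G)) :: complex"
  have "?N \<noteq> 0" using fin by auto
  have "(\<Sum>g\<in>carrier G. induced G H \<psi> g * cnj (\<chi> g))
      = (\<Sum>g\<in>carrier G. \<Sum>x\<in>carrier G. ?f (x \<otimes> g \<otimes> inv x) * cnj (\<chi> g)) / of_nat (card H)"
    by (simp add: induced_def Let_def sum_distrib_right sum_divide_distrib)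
  also have "(\<Sum>g\<in>carrier G. \<Sum>x\<in>carrier G. ?f (x \<otimes> g \<otimes> inv x) * cnj (\<chi> g))
      = (\<Sum>x\<in>carrier G. \<Sum>g\<in>carrier G. ?f (x \<otimes> g \<otimes> inv x) * cnj (\<chi> g))" by (rule sum.swap)
  also have "\<dots> = ?N * (\<Sum>h\<in>H. \<psi> h * cnj (\<chi> h))" by (simp add: inner)
  finally show ?thesis using \<open>?N \<noteq> 0\<close> by (simp add: char_inner_def)
qed

lemma (in group) is_rep_restrict:
  assumes H: "subgroup H G" and \<rho>: "is_rep G n \<rho>"
  shows "is_rep (G\<lparr>carrier := H\<rparr>) n \<rho>"
proof -
  interpret H: subgroup H G by (fact H)
  show ?thesis using \<rho> by (auto simp: is_rep_def)
qed

text \<open>Noncommuting endomorphisms force an irreducible representation of \<open>H\<close> to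
  occur at least twice in the restriction of \<open>\<rho>\<close>; reciprocity turns this
  multiplicity into an inner product with an induced character.\<close>

lemma (in group) strong_gelfand_pair_endomorphisms_commute:
  assumes fin: "finite (carrier G)" and H: "subgroup H G" and sgp: "strong_gelfand_pair G H"
    and \<rho>: "irr_rep G n \<rho>"
    and A: "intertwiner (G\<lparr>carrier := H\<rparr>) n \<rho> n \<rho> A" and B: "intertwiner (G\<lparr>carrier := H\<rparr>) n \<rho> n \<rho> B"
  shows "A * B = B * A"
proof (rule ccontr)
  assume ne: "A * B \<noteq> B * A"
  interpret H: subgroup H G by (fact H)
  let ?H = "G\<lparr>carrier := H\<rparr>"
  interpret HG: group ?H by (rule subgroup_imp_group[OF H])
  have finH: "finite (carrier ?H)" using fin H.subset by (simp add: finite_subset)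
  have inv: "inv\<^bsub>?H\<^esub> h = inv h" if "h \<in> H" for h by (rule m_inv_consistent[OF H that])
  have \<rho>r: "is_rep G n \<rho>" by (rule irr_rep_is_rep[OF \<rho>])
  obtain k \<tau> N where \<tau>: "irr_rep ?H k \<tau>" and N: "N \<ge> 2"
    and sum: "(\<Sum>h\<in>carrier ?H. mat_trace (\<rho> h) * mat_trace (\<tau> (inv\<^bsub>?H\<^esub> h))) = of_nat N * of_nat (card (carrier ?H))"
    by (rule HG.multiplicity_ge_2[OF finH is_rep_restrict[OF H \<rho>r] A B ne])
  define \<chi> where "\<chi> g = mat_trace (\<rho> g)" for g
  define \<psi> where "\<psi> h = mat_trace (\<tau> h)" for h
  have "char_inner G (induced G H \<psi>) \<chi> = (\<Sum>h\<in>H. \<psi> h * cnj (\<chi> h)) / of_nat (card H)"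
    by (rule frobenius_reciprocity[OF fin H \<rho>r]) (simp add: \<chi>_def)
  also have "(\<Sum>h\<in>H. \<psi> h * cnj (\<chi> h)) = (\<Sum>h\<in>H. mat_trace (\<rho> h) * mat_trace (\<tau> (inv h)))"
  \<comment> \<open>Inversion on \<open>H\<close> absorbs the complex conjugation, since
    \<open>mat_trace_inv\<close> reads \<open>cnj (\<chi> h)\<close> as the trace of
    \<open>\<rho> (inv h)\<close>.\<close>
  proof (rule sum.reindex_bij_witness[where i = "\<lambda>h. inv h" and j = "\<lambda>h. inv h"])
    fix h assume h: "h \<in> H"
    then have hG: "h \<in> carrier G" by simp
    show "inv (inv h) = h" using hG by simp
    then show "mat_trace (\<rho> (inv h)) * mat_trace (\<tau> (inv (inv h))) = \<psi> h * cnj (\<chi> h)"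
      using mat_trace_inv[OF fin \<rho>r hG] by (simp add: \<chi>_def \<psi>_def)
  qed auto
  also have "\<dots> = of_nat N * of_nat (card H)" using sum inv by simp
  also have "of_nat N * of_nat (card H) / of_nat (card H) = (of_nat N :: complex)"
  proof -
    have "H \<noteq> {}" using H.one_closed by blast
    then show ?thesis using finH by simp
  qed
  finally have "char_inner G (induced G H \<psi>) \<chi> = of_nat N" .
  moreover have "irr_char ?H \<psi>" "irr_char G \<chi>" using \<tau> \<rho> by (auto simp: irr_char_def \<psi>_def \<chi>_def)
  ultimately have "(of_nat N :: complex) \<le> 1" using sgp unfolding strong_gelfand_pair_def by metis
  \<comment> \<open>The order on complex numbers compares real parts and requires equal imaginary
    parts; between these real values it is the usual order.\<close>
  then show False using N by (simp add: less_eq_complex_def)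
qed

section \<open>The regular representation and coefficients in the group algebra\<close>

text \<open>Left multiplication on the group algebra in the basis of group elements, numbered by
  \<open>e\<close>. The column of the identity lists the coefficients of the element acting, so
  coefficients become matrix entries.\<close>

definition regular_rep :: "('g,'b) monoid_scheme \<Rightarrow> (nat \<Rightarrow> 'g) \<Rightarrow> 'g \<Rightarrow> complex mat" where
  "regular_rep G e g = mat (card (carrier G)) (card (carrier G)) (\<lambda>(i, j). if e i = g \<otimes>\<^bsub>G\<^esub> e j then 1 else 0)"

lemma (in group) is_rep_regular:
  assumes e: "bij_betw e {..<card (carrier G)} (carrier G)"
  shows "is_rep G (card (carrier G)) (regular_rep G e)"
  unfolding is_rep_def
proof (intro conjI ballI)
  let ?N = "card (carrier G)"
  have eG: "e i \<in> carrier G" if "i < ?N" for i using e that by (auto simp: bij_betw_def)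
  have inj: "e i = e j \<longleftrightarrow> i = j" if "i < ?N" "j < ?N" for i j
    using e that by (auto simp: bij_betw_def inj_on_def)
  show R: "regular_rep G e g \<in> carrier_mat ?N ?N" for g by (simp add: regular_rep_def)
  show "regular_rep G e \<one> = 1\<^sub>m ?N"
    by (intro eq_matI) (auto simp: regular_rep_def eG inj)
  fix g h assume g: "g \<in> carrier G" and h: "h \<in> carrier G"
  show "regular_rep G e (g \<otimes> h) = regular_rep G e g * regular_rep G e h"
  proof (rule eq_matI)
    fix i j assume "i < dim_row (regular_rep G e g * regular_rep G e h)"
      "j < dim_col (regular_rep G e g * regular_rep G e h)"
    then have ij: "i < ?N" "j < ?N" by (auto simp: regular_rep_def)
    obtain l where l: "l < ?N" "e l = h \<otimes> e j"
      using e h eG[OF ij(2)] by (metis bij_betw_def imageE lessThan_iff m_closed)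
    have "(regular_rep G e g * regular_rep G e h) $$ (i, j)
        = (\<Sum>t<?N. regular_rep G e g $$ (i, t) * regular_rep G e h $$ (t, j))"
      by (rule index_mult_mat_sum[OF R R ij])
    also have "\<dots> = (\<Sum>t<?N. if t = l then regular_rep G e g $$ (i, l) else 0)"
      using l ij by (intro sum.cong) (auto simp: regular_rep_def inj simp flip: l(2))
    also have "\<dots> = regular_rep G e (g \<otimes> h) $$ (i, j)"
      using l ij g h eG by (simp add: regular_rep_def m_assoc)
    finally show "regular_rep G e (g \<otimes> h) $$ (i, j) = (regular_rep G e g * regular_rep G e h) $$ (i, j)" by simp
  qed (auto simp: regular_rep_def)
qed

lemma (in group) strong_gelfand_pair_swap_conjugates:
  assumes fin: "finite (carrier G)" and H: "subgroup H G" and sgp: "strong_gelfand_pair G H"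
    and x: "x \<in> carrier G" and y: "y \<in> carrier G"
  shows "\<exists>h\<in>H. \<exists>k\<in>H. x \<otimes> y = (k \<otimes> y \<otimes> inv k) \<otimes> (h \<otimes> x \<otimes> inv h)"
proof -
  interpret H: subgroup H G by (fact H)
  let ?H = "G\<lparr>carrier := H\<rparr>"
  interpret HG: group ?H by (rule subgroup_imp_group[OF H])
  have finH: "finite H" using fin H.subset by (simp add: finite_subset)
  have inv: "inv\<^bsub>?H\<^esub> h = inv h" if "h \<in> H" for h by (rule m_inv_consistent[OF H that])
  let ?conj = "\<lambda>h z. h \<otimes> z \<otimes> inv h"
  have cG: "?conj h z \<in> carrier G" if "h \<in> H" "z \<in> carrier G" for h z using that by simp
  define C where "C n \<rho> z = msum n n (\<lambda>h. \<rho> (?conj h z)) H" for n and \<rho> :: "'a \<Rightarrow> complex mat" and z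
  have C: "C n \<rho> z \<in> carrier_mat n n" for n \<rho> z by (simp add: C_def)
  have C_end: "intertwiner ?H n \<rho> n \<rho> (C n \<rho> z)" if \<rho>: "is_rep G n \<rho>" and z: "z \<in> carrier G" for n \<rho> z
  proof -
    have "C n \<rho> z = msum n n (\<lambda>h. \<rho> h * \<rho> z * \<rho> (inv\<^bsub>?H\<^esub> h)) (carrier ?H)"
      unfolding C_def by (simp, rule msum_cong) (use z in \<open>simp add: inv is_rep_mult[OF \<rho>]\<close>)
    then show ?thesis
      using HG.intertwiner_average[OF is_rep_restrict[OF H \<rho>] is_rep_restrict[OF H \<rho>] is_rep_carrier[OF \<rho> z]] by simp
  qed
  \<comment> \<open>The operator \<open>C\<close> is a sum of values of the representation, so every
    embedding \<open>J\<close> carries it from a constituent to the whole space. This transports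
    commutation from the irreducible representations to the regular one.\<close>
  have C_split: "C n \<sigma> z * J = J * C k \<tau> z"
    if \<sigma>: "is_rep G n \<sigma>" and s: "split_rep G n \<sigma> k \<tau> J P" and z: "z \<in> carrier G" for n \<sigma> k \<tau> J P z
  proof -
    have \<tau>: "is_rep G k \<tau>" and J: "J \<in> carrier_mat n k" and com: "\<And>g. g \<in> carrier G \<Longrightarrow> \<sigma> g * J = J * \<tau> g"
      using s by (auto simp: split_rep_def intertwiner_def)
    have "C n \<sigma> z * J = msum n k (\<lambda>h. \<sigma> (?conj h z) * J) H"
      unfolding C_def by (rule msum_mult[OF J is_rep_carrier[OF \<sigma> cG[OF _ z]]])
    also have "\<dots> = msum n k (\<lambda>h. J * \<tau> (?conj h z)) H"
      by (rule msum_cong) (use com cG z in simp)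
    also have "\<dots> = J * C k \<tau> z"
      unfolding C_def by (rule mult_msum[symmetric, OF J is_rep_carrier[OF \<tau> cG[OF _ z]]])
    finally show ?thesis .
  qed
  let ?N = "card (carrier G)"
  obtain e where e: "bij_betw e {..<?N} (carrier G)"
    using ex_bij_betw_nat_finite[OF fin] by (auto simp: atLeast0LessThan)
  let ?R = "regular_rep G e"
  note R = is_rep_regular[OF e]
  obtain r d where d: "decomposes G ?N ?R r d" using ex_decomposition[OF fin R] by blast
  have comm: "C ?N ?R x * C ?N ?R y = C ?N ?R y * C ?N ?R x"
  proof (rule mult_eq_if_projectors[OF d])
    fix i k \<tau> J P assume i: "i < r" and di: "d i = (k, \<tau>, J, P)"
    then have "constituent G ?N ?R (k, \<tau>, J, P)" using d by (metis decomposes_def)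
    then have irr: "irr_rep G k \<tau>" and s: "split_rep G ?N ?R k \<tau> J P" by (auto simp: constituent_def)
    then have J: "J \<in> carrier_mat ?N k" and \<tau>: "is_rep G k \<tau>" by (auto simp: split_rep_def intertwiner_def)
    have prod: "C ?N ?R u * C ?N ?R v * J = J * (C k \<tau> u * C k \<tau> v)"
      if u: "u \<in> carrier G" and v: "v \<in> carrier G" for u v
      unfolding assoc_mult_mat[OF C C J] C_split[OF R s v]
      unfolding assoc_mult_mat[OF C J C, symmetric] C_split[OF R s u]
      by (rule assoc_mult_mat[OF J C C])
    have "C k \<tau> x * C k \<tau> y = C k \<tau> y * C k \<tau> x"
      by (rule strong_gelfand_pair_endomorphisms_commute[OF fin H sgp irr C_end[OF \<tau> x] C_end[OF \<tau> y]])
    then show "C ?N ?R x * C ?N ?R y * J = C ?N ?R y * C ?N ?R x * J"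
      unfolding prod[OF x y] prod[OF y x] by simp
  qed (use C in \<open>auto intro: mult_carrier_mat\<close>)
  \<comment> \<open>Row \<open>x \<otimes> y\<close> and the column of the identity: this entry is
    the coefficient of \<open>x \<otimes> y\<close>.\<close>
  obtain i where i: "i < ?N" "e i = x \<otimes> y"
    using e m_closed[OF x y] by (metis bij_betw_def imageE lessThan_iff)
  obtain j where j: "j < ?N" "e j = \<one>"
    using e one_closed by (metis bij_betw_def imageE lessThan_iff)
  have entry: "(C ?N ?R u * C ?N ?R v) $$ (i, j)
      = (\<Sum>h\<in>H. \<Sum>k\<in>H. if x \<otimes> y = ?conj h u \<otimes> ?conj k v then 1 else 0)"
    if u: "u \<in> carrier G" and v: "v \<in> carrier G" for u v
  proof -
    have "C ?N ?R u * C ?N ?R v = msum ?N ?N (\<lambda>h. ?R (?conj h u) * C ?N ?R v) H"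
      unfolding C_def[of ?N ?R u] by (rule msum_mult[OF C is_rep_carrier[OF R cG[OF _ u]]])
    also have "\<dots> = msum ?N ?N (\<lambda>h. msum ?N ?N (\<lambda>k. ?R (?conj h u) * ?R (?conj k v)) H) H"
      unfolding C_def
      by (rule msum_cong, rule mult_msum[OF is_rep_carrier[OF R cG[OF _ u]] is_rep_carrier[OF R cG[OF _ v]]])
    finally have eq: "C ?N ?R u * C ?N ?R v
        = msum ?N ?N (\<lambda>h. msum ?N ?N (\<lambda>k. ?R (?conj h u) * ?R (?conj k v)) H) H" .
    have "(C ?N ?R u * C ?N ?R v) $$ (i, j) = (\<Sum>h\<in>H. \<Sum>k\<in>H. (?R (?conj h u) * ?R (?conj k v)) $$ (i, j))"
      by (simp only: eq msum_index[OF i(1) j(1)])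
    also have "\<dots> = (\<Sum>h\<in>H. \<Sum>k\<in>H. if x \<otimes> y = ?conj h u \<otimes> ?conj k v then 1 else 0)"
    proof (intro sum.cong refl)
      fix h k assume hk: "h \<in> H" "k \<in> H"
      have "?R (?conj h u) * ?R (?conj k v) = ?R (?conj h u \<otimes> ?conj k v)"
        by (rule is_rep_mult[symmetric, OF R cG[OF hk(1) u] cG[OF hk(2) v]])
      then show "(?R (?conj h u) * ?R (?conj k v)) $$ (i, j) = (if x \<otimes> y = ?conj h u \<otimes> ?conj k v then 1 else 0)"
        using i j cG[OF hk(1) u] cG[OF hk(2) v] by (simp add: regular_rep_def del: index_mult_mat(1))
    qed
    finally show ?thesis .
  qed
  show ?thesis
  proof (rule ccontr)
    assume "\<not> ?thesis"
    then have no: "x \<otimes> y \<noteq> ?conj h y \<otimes> ?conj k x" if "h \<in> H" "k \<in> H" for h k using that by blast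
    \<comment> \<open>Both coefficients count pairs, so nothing can cancel. The pair
      \<open>(\<one>, \<one>)\<close> makes the first count positive, hence the second cannot be
      zero; passing to the reals makes nonnegativity available.\<close>
    have "(\<Sum>h\<in>H. \<Sum>k\<in>H. if x \<otimes> y = ?conj h x \<otimes> ?conj k y then 1 else 0 :: complex)
        = (\<Sum>h\<in>H. \<Sum>k\<in>H. if x \<otimes> y = ?conj h y \<otimes> ?conj k x then 1 else 0)"
      unfolding entry[OF x y, symmetric] entry[OF y x, symmetric] comm ..
    also have "\<dots> = 0" by (intro sum.neutral ballI) (simp add: no)
    finally have "complex_of_real (\<Sum>h\<in>H. \<Sum>k\<in>H. if x \<otimes> y = ?conj h x \<otimes> ?conj k y then 1 else 0) = 0"
      by (simp add: if_distrib[of complex_of_real] cong: if_cong)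
    then have "(\<Sum>h\<in>H. \<Sum>k\<in>H. if x \<otimes> y = ?conj h x \<otimes> ?conj k y then 1 else 0 :: real) = 0"
      by (simp only: of_real_eq_0_iff)
    then have "\<forall>h\<in>H. (\<Sum>k\<in>H. if x \<otimes> y = ?conj h x \<otimes> ?conj k y then 1 else 0 :: real) = 0"
      by (subst (asm) sum_nonneg_eq_0_iff[OF finH]) (auto intro: sum_nonneg)
    then have "(\<Sum>k\<in>H. if x \<otimes> y = ?conj \<one> x \<otimes> ?conj k y then 1 else 0 :: real) = 0"
      using H.one_closed by blast
    then have "\<forall>k\<in>H. (if x \<otimes> y = ?conj \<one> x \<otimes> ?conj k y then 1 else 0 :: real) = 0"
      by (subst (asm) sum_nonneg_eq_0_iff[OF finH]) auto
    then have "(if x \<otimes> y = ?conj \<one> x \<otimes> ?conj \<one> y then 1 else 0 :: real) = 0"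
      using H.one_closed by blast
    then show False using x y by simp
  qed
qed

section \<open>The symplectic group over a quadratic extension\<close>

lemma card_unity_roots_le:
  assumes "n > 0"
  shows "card {x :: 'a::idom. x ^ n = 1} \<le> n"
proof -
  define p :: "'a poly" where "p = monom 1 n - 1"
  have "coeff p n = 1" using assms by (simp add: p_def)
  then have "p \<noteq> 0" by auto
  have "{x. poly p x = 0} = {x. x ^ n = 1}" by (auto simp: p_def poly_monom)
  moreover have "degree p \<le> n" unfolding p_def by (intro degree_diff_le) (auto simp: degree_monom_le)
  ultimately show ?thesis using card_poly_roots_bound[OF \<open>p \<noteq> 0\<close>] by simp
qed

text \<open>\<open>bar\<close> is the Galois involution of \<open>'K\<close> over
  \<open>F_q\<close>. As a parameter it stays folded, so that rewriting sees a field automorphism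
  and not a power.\<close>

locale quadratic_extension =
  fixes e q :: nat and bar :: "'K::{field,finite} \<Rightarrow> 'K"
  assumes q_eq: "q = 2 ^ e" and e_gt_1: "e > 1" and card_K: "card (UNIV :: 'K set) = q ^ 2"
    and bar_eq: "bar x = x ^ q"
begin

lemma q_ge_4: "q \<ge> 4"
proof -
  have "(2::nat) ^ 2 \<le> 2 ^ e" using e_gt_1 by (intro power_increasing) auto
  then show ?thesis by (simp add: q_eq)
qed

section \<open>Arithmetic of \<open>F_{q^2}\<close> in characteristic 2\<close>

text \<open>Translation by 1 permutes the field, so comparing the sum of all elements before and
  after shows that the cardinality, a power of 2, is zero in the field.\<close>

lemma char_2: "CHAR('K) = 2"
proof -
  have "(\<Sum>x\<in>UNIV. x :: 'K) = (\<Sum>x\<in>UNIV. x + 1)"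
    by (rule sum.reindex_bij_witness[of _ "\<lambda>x. x + 1" "\<lambda>x. x - 1"]) auto
  then have "of_nat (card (UNIV :: 'K set)) = (0 :: 'K)" by (simp add: sum.distrib)
  then have "CHAR('K) dvd 2 ^ (e * 2)"
    unfolding of_nat_eq_0_iff_char_dvd card_K q_eq power_mult .
  moreover have "prime CHAR('K)"
    by (rule prime_CHAR_semidom) (rule finite_imp_CHAR_pos, simp)
  ultimately show ?thesis by (metis prime_dvd_power primes_dvd_imp_eq two_is_prime_nat)
qed

lemma double_eq_0: "x + x = (0 :: 'K)"
  using of_nat_CHAR[where 'a = 'K] by (simp add: char_2 flip: mult_2)

lemma minus_eq: "- x = (x :: 'K)"
  using double_eq_0[of x] by (metis add_eq_0_iff)

lemma diff_eq: "x - y = x + (y :: 'K)"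
  by (metis diff_conv_add_uminus minus_eq)

lemma eq_if_add_eq_0: "x + y = 0 \<Longrightarrow> x = (y :: 'K)"
  by (metis add_eq_0_iff minus_eq)

lemma bar_add [simp]: "bar (x + y) = bar x + bar y"
  unfolding bar_eq by (rule freshmans_dream'[where n = e]) (simp_all add: char_2 q_eq)

lemma bar_mult [simp]: "bar (x * y) = bar x * bar y"
  by (simp add: bar_eq power_mult_distrib)

lemma bar_0 [simp]: "bar 0 = 0" and bar_1 [simp]: "bar 1 = 1"
  using q_ge_4 by (auto simp: bar_eq)

lemma bar_diff [simp]: "bar (x - y) = bar x - bar y"
  by (simp add: diff_eq)

lemma bar_divide [simp]: "bar (x / y) = bar x / bar y"
  by (simp add: bar_eq power_divide)

lemma bar_power [simp]: "bar (x ^ n) = bar x ^ n"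
  by (simp add: bar_eq mult.commute flip: power_mult)

text \<open>Multiplication by a nonzero \<open>x\<close> permutes the nonzero elements; comparing
  their products gives \<open>x ^ (q ^ 2 - 1) = 1\<close>, and applying \<open>bar\<close> twice is
  raising to the power \<open>q ^ 2\<close>.\<close>

lemma bar_bar [simp]: "bar (bar x) = x"
proof (cases "x = 0")
  case False
  have "(\<Prod>y\<in>UNIV - {0}. y) = (\<Prod>y\<in>UNIV - {0}. x * y)"
    by (rule prod.reindex_bij_witness[of _ "\<lambda>y. x * y" "\<lambda>y. y / x"]) (use False in auto)
  also have "\<dots> = x ^ (q ^ 2 - 1) * (\<Prod>y\<in>UNIV - {0}. y)"
    by (simp add: prod.distrib card_K)
  finally have "x ^ (q ^ 2 - 1) = 1" by simp
  then have "x * x ^ (q ^ 2 - 1) = x" by simp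
  then have "x ^ (q ^ 2) = x" using q_ge_4 by (cases "q ^ 2") auto
  then show ?thesis by (simp add: bar_eq power2_eq_square flip: power_mult)
qed simp

lemma subfield_q_iff: "c \<in> subfield_q q \<longleftrightarrow> bar c = c"
  by (simp add: subfield_q_def bar_eq)

lemma sympl_form_eq: "sympl_form q u v = (let d = fst u * snd v - snd u * fst v in d + bar d)"
  by (simp add: sympl_form_def bar_eq)

text \<open>Nonzero fixed elements satisfy \<open>x ^ (q - 1) = 1\<close>, so at most
  \<open>q\<close> of the \<open>q ^ 2\<close> elements are fixed. Such a \<open>t\<close> is what
  distinguishes linear from semilinear maps.\<close>

lemma ex_not_fixed: "\<exists>t. bar t \<noteq> t"
proof (rule ccontr)
  assume "\<not> ?thesis"
  then have "x ^ q = x" for x :: 'K by (simp add: bar_eq)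
  then have "x ^ (q - 1) = 1" if "x \<noteq> 0" for x :: 'K
    using that q_ge_4 power_eq_if[of x q] by auto
  then have "UNIV \<subseteq> insert 0 {x :: 'K. x ^ (q - 1) = 1}" by auto
  then have "q ^ 2 \<le> card (insert 0 {x :: 'K. x ^ (q - 1) = 1})"
    unfolding card_K[symmetric] by (rule card_mono[rotated]) simp
  also have "\<dots> \<le> Suc (card {x :: 'K. x ^ (q - 1) = 1})" by (rule card_insert_le_m1) auto
  also have "\<dots> \<le> Suc (q - 1)" using card_unity_roots_le[of "q - 1", where 'a = 'K] q_ge_4 by simp
  also have "\<dots> < q ^ 2" using q_ge_4 by (simp add: power2_eq_square)
  finally show False by simp
qed

text \<open>The element is a norm \<open>t * bar t\<close>; norm-one elements together with \<open>0\<close> number at most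
  \<open>q + 2\<close>, which is less than \<open>q\<^sup>2\<close> only because \<open>e > 1\<close>.\<close>
lemma ex_fixed_not_0_1: "\<exists>D. bar D = D \<and> D \<noteq> 0 \<and> D \<noteq> 1"
proof -
  have "\<exists>t :: 'K. t \<noteq> 0 \<and> t ^ (q + 1) \<noteq> 1"
  proof (rule ccontr)
    assume "\<not> ?thesis"
    then have "UNIV \<subseteq> insert 0 {x :: 'K. x ^ (q + 1) = 1}" by auto
    then have "q ^ 2 \<le> card (insert 0 {x :: 'K. x ^ (q + 1) = 1})"
      unfolding card_K[symmetric] by (rule card_mono[rotated]) simp
    also have "\<dots> \<le> Suc (card {x :: 'K. x ^ (q + 1) = 1})" by (rule card_insert_le_m1) auto
    also have "\<dots> \<le> Suc (q + 1)" using card_unity_roots_le[of "q + 1", where 'a = 'K] by simp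
    also have "\<dots> < 4 * q" using q_ge_4 by simp
    also have "\<dots> \<le> q ^ 2" using q_ge_4 by (simp add: power2_eq_square)
    finally show False by simp
  qed
  then obtain t :: 'K where t: "t \<noteq> 0" "t ^ (q + 1) \<noteq> 1" by blast
  have "t * bar t = t ^ (q + 1)" by (simp add: bar_eq)
  moreover have "bar (t * bar t) = t * bar t" by (simp add: mult.commute)
  ultimately show ?thesis using t by (intro exI[of _ "t * bar t"]) auto
qed

section \<open>The group \<open>Sp_4(q)\<close> and its subgroup \<open>Sp_2(q^2):2\<close>\<close>

lemma Sp4_carrierI:
  assumes "bij g" "\<And>u v. g (padd u v) = padd (g u) (g v)"
    "\<And>c v. bar c = c \<Longrightarrow> g (psmult c v) = psmult c (g v)"
    "\<And>u v. sympl_form q (g u) (g v) = sympl_form q u v"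
  shows "g \<in> Sp4_carrier q"
  using assms by (simp add: Sp4_carrier_def subfield_q_iff)

lemma Sp4_carrierD:
  assumes "g \<in> Sp4_carrier q"
  shows "bij g" "g (padd u v) = padd (g u) (g v)"
    "bar c = c \<Longrightarrow> g (psmult c v) = psmult c (g v)"
    "sympl_form q (g u) (g v) = sympl_form q u v"
  using assms unfolding Sp4_carrier_def mem_Collect_eq Ball_def subfield_q_iff by blast+

lemma group_Sp4: "group (Sp4 q :: ('K \<times> 'K \<Rightarrow> 'K \<times> 'K) monoid)"
proof (rule groupI)
  fix g h :: "'K \<times> 'K \<Rightarrow> 'K \<times> 'K" assume g: "g \<in> carrier (Sp4 q)" and h: "h \<in> carrier (Sp4 q)"
  note g = g[unfolded Sp4_def, simplified] and h = h[unfolded Sp4_def, simplified]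
  have "g \<circ> h \<in> Sp4_carrier q"
    by (rule Sp4_carrierI) (simp_all add: bij_comp Sp4_carrierD(1)[OF g] Sp4_carrierD(1)[OF h]
        Sp4_carrierD(2-4)[OF g] Sp4_carrierD(2-4)[OF h])
  then show "g \<otimes>\<^bsub>Sp4 q\<^esub> h \<in> carrier (Sp4 q)" by (simp add: Sp4_def)
next
  show "\<one>\<^bsub>Sp4 q\<^esub> \<in> carrier (Sp4 q :: ('K \<times> 'K \<Rightarrow> 'K \<times> 'K) monoid)"
    by (simp add: Sp4_def Sp4_carrierI)
next
  fix g :: "'K \<times> 'K \<Rightarrow> 'K \<times> 'K" assume g: "g \<in> carrier (Sp4 q)"
  note g = g[unfolded Sp4_def, simplified]
  let ?g' = "inv_into UNIV g"
  have bij: "bij g" by (rule Sp4_carrierD(1)[OF g])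
  have 1: "g (?g' u) = u" for u using bij by (simp add: bij_is_surj surj_f_inv_f)
  have 2: "u = ?g' v" if "g u = v" for u v using bij that by (metis bij_inv_eq_iff)
  have "?g' \<in> Sp4_carrier q"
  proof (rule Sp4_carrierI)
    show "bij ?g'" by (rule bij_imp_bij_inv[OF bij])
    show "?g' (padd u v) = padd (?g' u) (?g' v)" for u v
      by (rule 2[symmetric]) (simp add: Sp4_carrierD(2)[OF g] 1)
    show "?g' (psmult c v) = psmult c (?g' v)" if "bar c = c" for c v
      by (rule 2[symmetric]) (simp add: Sp4_carrierD(3)[OF g that] 1)
    show "sympl_form q (?g' u) (?g' v) = sympl_form q u v" for u v
      using Sp4_carrierD(4)[OF g, of "?g' u" "?g' v"] by (simp add: 1)
  qed
  moreover have "?g' \<circ> g = id" using bij by (simp add: bij_is_inj)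
  ultimately show "\<exists>h\<in>carrier (Sp4 q). h \<otimes>\<^bsub>Sp4 q\<^esub> g = \<one>\<^bsub>Sp4 q\<^esub>"
    by (auto simp: Sp4_def)
qed (auto simp: Sp4_def comp_assoc)

lemma Sp4_inverse:
  fixes g :: "'K \<times> 'K \<Rightarrow> 'K \<times> 'K"
  assumes "g \<in> Sp4_carrier q"
  shows "inv\<^bsub>Sp4 q\<^esub> g \<in> Sp4_carrier q" "g ((inv\<^bsub>Sp4 q\<^esub> g) u) = u" "(inv\<^bsub>Sp4 q\<^esub> g) (g u) = u"
proof -
  interpret group "Sp4 q :: ('K \<times> 'K \<Rightarrow> 'K \<times> 'K) monoid" by (rule group_Sp4)
  have g: "g \<in> carrier (Sp4 q)" using assms by (simp add: Sp4_def)
  show "inv\<^bsub>Sp4 q\<^esub> g \<in> Sp4_carrier q" using inv_closed[OF g] by (simp add: Sp4_def)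
  have "g \<circ> inv\<^bsub>Sp4 q\<^esub> g = id" "inv\<^bsub>Sp4 q\<^esub> g \<circ> g = id"
    using r_inv[OF g] l_inv[OF g] by (auto simp: Sp4_def)
  then show "g ((inv\<^bsub>Sp4 q\<^esub> g) u) = u" "(inv\<^bsub>Sp4 q\<^esub> g) (g u) = u" by (metis comp_apply id_apply)+
qed

text \<open>Homogeneity alone: additivity is already part of membership in
  \<open>Sp4_carrier\<close>, and for conjugated maps it is a separate conclusion of
  \<open>conj_invol\<close>.\<close>

definition semilinear :: "('K \<Rightarrow> 'K) \<Rightarrow> ('K \<times> 'K \<Rightarrow> 'K \<times> 'K) \<Rightarrow> bool" where
  "semilinear \<tau> g \<longleftrightarrow> (\<forall>c v. g (psmult c v) = psmult (\<tau> c) (g v))"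

lemma semilinearI: "(\<And>c v. g (psmult c v) = psmult (\<tau> c) (g v)) \<Longrightarrow> semilinear \<tau> g"
  and semilinearD: "semilinear \<tau> g \<Longrightarrow> g (psmult c v) = psmult (\<tau> c) (g v)"
  unfolding semilinear_def by blast+

lemma Sp2_ext_2_iff:
  "g \<in> Sp2_ext_2 q \<longleftrightarrow> g \<in> Sp4_carrier q \<and> (\<exists>\<tau>\<in>{\<lambda>c. c, bar}. semilinear \<tau> g)"
  by (auto simp: Sp2_ext_2_def semilinear_def bar_eq)

text \<open>The inverse of a \<open>\<tau>\<close>-semilinear map is semilinear for the inverse of
  \<open>\<tau>\<close>, and both the identity and \<open>bar\<close> are their own
  inverses.\<close>

lemma semilinear_inverse:
  assumes "g \<in> Sp4_carrier q" "semilinear \<tau> g" "\<tau> \<in> {\<lambda>c. c, bar}"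
  shows "semilinear \<tau> (inv\<^bsub>Sp4 q\<^esub> g)"
proof (rule semilinearI)
  fix c v
  let ?g' = "inv\<^bsub>Sp4 q\<^esub> g"
  have "g (psmult (\<tau> c) (?g' v)) = psmult c v"
    using assms(3) by (auto simp: semilinearD[OF assms(2)] Sp4_inverse(2)[OF assms(1)])
  then have "?g' (psmult c v) = ?g' (g (psmult (\<tau> c) (?g' v)))" by simp
  then show "?g' (psmult c v) = psmult (\<tau> c) (?g' v)" by (simp add: Sp4_inverse(3)[OF assms(1)])
qed

lemma subgroup_Sp2_ext_2: "subgroup (Sp2_ext_2 q) (Sp4 q :: ('K \<times> 'K \<Rightarrow> 'K \<times> 'K) monoid)"
proof -
  interpret group "Sp4 q :: ('K \<times> 'K \<Rightarrow> 'K \<times> 'K) monoid" by (rule group_Sp4)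
  show ?thesis
  proof (rule subgroupI)
    show "Sp2_ext_2 q \<subseteq> carrier (Sp4 q :: ('K \<times> 'K \<Rightarrow> 'K \<times> 'K) monoid)"
      by (auto simp: Sp2_ext_2_def Sp4_def)
    have "id \<in> (Sp2_ext_2 q :: ('K \<times> 'K \<Rightarrow> 'K \<times> 'K) set)"
      by (simp add: Sp2_ext_2_iff semilinear_def Sp4_carrierI)
    then show "Sp2_ext_2 q \<noteq> ({} :: ('K \<times> 'K \<Rightarrow> 'K \<times> 'K) set)" by blast
    show "inv\<^bsub>Sp4 q\<^esub> g \<in> Sp2_ext_2 q" if "g \<in> Sp2_ext_2 q" for g :: "'K \<times> 'K \<Rightarrow> 'K \<times> 'K"
      using that semilinear_inverse Sp4_inverse(1) unfolding Sp2_ext_2_iff by blast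
    show "g \<otimes>\<^bsub>Sp4 q\<^esub> h \<in> Sp2_ext_2 q" if gh: "g \<in> Sp2_ext_2 q" "h \<in> Sp2_ext_2 q"
      for g h :: "'K \<times> 'K \<Rightarrow> 'K \<times> 'K"
    proof -
      have "g \<otimes>\<^bsub>Sp4 q\<^esub> h \<in> carrier (Sp4 q)"
        by (rule m_closed) (use gh in \<open>auto simp: Sp2_ext_2_def Sp4_def\<close>)
      moreover obtain \<sigma> \<tau> where "semilinear \<sigma> g" "semilinear \<tau> h" "\<sigma> \<in> {\<lambda>c. c, bar}" "\<tau> \<in> {\<lambda>c. c, bar}"
        using gh unfolding Sp2_ext_2_iff by blast
      then have "semilinear (\<lambda>c. \<sigma> (\<tau> c)) (g \<circ> h)" "(\<lambda>c. \<sigma> (\<tau> c)) \<in> {\<lambda>c. c, bar}"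
        by (auto intro!: semilinearI simp: semilinearD)
      ultimately show ?thesis unfolding Sp2_ext_2_iff by (auto simp: Sp4_def)
    qed
  qed
qed

section \<open>Symplectic involutions with scalar linear part\<close>

text \<open>Apply \<open>bar\<close> to both coordinates, then the antidiagonal matrix with upper
  entry \<open>r\<close> and lower entry \<open>s\<close>.\<close>

definition nu :: "'K \<Rightarrow> 'K \<Rightarrow> 'K \<times> 'K \<Rightarrow> 'K \<times> 'K" where
  "nu r s u = (r * bar (snd u), s * bar (fst u))"

definition invol :: "'K \<Rightarrow> 'K \<Rightarrow> 'K \<Rightarrow> 'K \<times> 'K \<Rightarrow> 'K \<times> 'K" where
  "invol C r s u = padd (psmult C u) (nu r s u)"

text \<open>The mixed terms of the square occur twice and cancel in characteristic 2, leaving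
  \<open>C\<^sup>2 + r * s = 1\<close>; so the map is an involution. The form is multiplied by
  \<open>C\<^sup>2 - r * s\<close>, which is 1 for the same reason.\<close>

lemma invol_in_Sp4:
  assumes C: "bar C = C" and r: "bar r = r" and s: "bar s = s" and rs: "r * s = 1 + C\<^sup>2"
  shows "invol C r s \<in> Sp4_carrier q"
proof (rule Sp4_carrierI)
  have "invol C r s (invol C r s u) = u" for u
  proof -
    have "fst (invol C r s (invol C r s u)) = (C\<^sup>2 + r * s) * fst u + (C * r * bar (snd u) + C * r * bar (snd u))"
      by (simp add: invol_def nu_def padd_def psmult_def C r s algebra_simps power2_eq_square)
    moreover have "snd (invol C r s (invol C r s u)) = (C\<^sup>2 + r * s) * snd u + (C * s * bar (fst u) + C * s * bar (fst u))"
      by (simp add: invol_def nu_def padd_def psmult_def C r s algebra_simps power2_eq_square)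
    moreover have "C\<^sup>2 + r * s = 1" using rs double_eq_0[of "C\<^sup>2"] by (simp add: algebra_simps)
    ultimately show ?thesis by (simp add: double_eq_0 prod_eq_iff)
  qed
  then show "bij (invol C r s)" by (rule involuntory_imp_bij)
  show "invol C r s (padd u v) = padd (invol C r s u) (invol C r s v)" for u v
    by (simp add: invol_def nu_def padd_def psmult_def algebra_simps)
  show "invol C r s (psmult c v) = psmult c (invol C r s v)" if "bar c = c" for c v
    by (simp add: invol_def nu_def padd_def psmult_def that algebra_simps)
  fix u v :: "'K \<times> 'K"
  obtain a b where u: "u = (a, b)" by (cases u)
  obtain c d where v: "v = (c, d)" by (cases v)
  let ?d = "a * d - b * c"
  \<comment> \<open>The determinant also acquires mixed terms, but they are multiples by elements of
    \<open>F_q\<close> of \<open>z - bar z\<close> with \<open>z = a * bar c\<close> or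
    \<open>z = bar b * d\<close>. Adding the conjugate kills them, so the trace form is preserved up
    to a factor although the determinant itself need not be.\<close>
  have "sympl_form q (invol C r s u) (invol C r s v) = (C\<^sup>2 - r * s) * (?d + bar ?d)"
    by (simp add: u v sympl_form_eq invol_def nu_def padd_def psmult_def C r s Let_def algebra_simps power2_eq_square)
  also have "C\<^sup>2 - r * s = 1"
    using double_eq_0[of "C\<^sup>2"] by (simp add: diff_eq rs algebra_simps)
  finally show "sympl_form q (invol C r s u) (invol C r s v) = sympl_form q u v"
    by (simp add: u v sympl_form_eq Let_def)
qed

text \<open>\<open>h\<close> commutes with the scalar \<open>C\<close> because \<open>C\<close> lies
  in \<open>F_q\<close>, so conjugation changes only the semilinear part. That part stays
  \<open>bar\<close>-semilinear because \<open>bar\<close> commutes with the identity and with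
  itself.\<close>

lemma conj_invol:
  fixes r s :: 'K
  assumes h: "h \<in> Sp2_ext_2 q" and C: "bar C = C"
  defines "\<mu> \<equiv> \<lambda>u. h (nu r s ((inv\<^bsub>Sp4 q\<^esub> h) u))"
  shows "h (invol C r s ((inv\<^bsub>Sp4 q\<^esub> h) u)) = padd (psmult C u) (\<mu> u)"
    and "semilinear bar \<mu>" and "\<mu> (padd u v) = padd (\<mu> u) (\<mu> v)"
proof -
  from h obtain \<tau> where hS: "h \<in> Sp4_carrier q" and \<tau>: "semilinear \<tau> h" "\<tau> \<in> {\<lambda>c. c, bar}"
    by (auto simp: Sp2_ext_2_iff)
  note h' = Sp4_inverse[OF hS]
  have "h (invol C r s ((inv\<^bsub>Sp4 q\<^esub> h) u))
      = padd (psmult C (h ((inv\<^bsub>Sp4 q\<^esub> h) u))) (\<mu> u)"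
    by (simp add: invol_def Sp4_carrierD(2)[OF hS] Sp4_carrierD(3)[OF hS C] \<mu>_def)
  then show "h (invol C r s ((inv\<^bsub>Sp4 q\<^esub> h) u)) = padd (psmult C u) (\<mu> u)" by (simp add: h'(2))
  have nu: "nu r s (psmult c v) = psmult (bar c) (nu r s v)" for c v
    by (simp add: nu_def psmult_def)
  show "semilinear bar \<mu>"
    using \<tau>(2) by (intro semilinearI)
      (auto simp: \<mu>_def nu semilinearD[OF \<tau>(1)] semilinearD[OF semilinear_inverse[OF hS \<tau>]])
  have "nu r s (padd u v) = padd (nu r s u) (nu r s v)" for u v
    by (simp add: nu_def padd_def algebra_simps)
  then show "\<mu> (padd u v) = padd (\<mu> u) (\<mu> v)"
    by (simp add: \<mu>_def Sp4_carrierD(2)[OF hS] Sp4_carrierD(2)[OF h'(1)])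
qed

lemma conj_nu_square_0:
  assumes h: "h \<in> Sp2_ext_2 q"
  defines "\<mu> \<equiv> \<lambda>u. h (nu 1 0 ((inv\<^bsub>Sp4 q\<^esub> h) u))"
  shows "\<mu> (\<mu> u) = (0, 0)"
proof -
  have hS: "h \<in> Sp4_carrier q" using h by (simp add: Sp2_ext_2_iff)
  have "\<mu> (\<mu> u) = h (nu 1 0 (nu 1 0 ((inv\<^bsub>Sp4 q\<^esub> h) u)))"
    by (simp add: \<mu>_def Sp4_inverse(3)[OF hS])
  \<comment> \<open>The zero vector is written as a multiple by 0 so that
    \<open>F_q\<close>-homogeneity of \<open>h\<close> shows that it is mapped to itself.\<close>
  also have "\<dots> = h (psmult 0 (0, 0))" by (simp add: nu_def psmult_def)
  also have "\<dots> = (0, 0)" using Sp4_carrierD(3)[OF hS bar_0] by (simp add: psmult_def)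
  finally show ?thesis .
qed

section \<open>Comparison of linear and semilinear parts\<close>

text \<open>Independence of the automorphisms identity and \<open>bar\<close>: evaluate at
  \<open>u\<close> and at \<open>t u\<close> with \<open>bar t \<noteq> t\<close>, and eliminate the
  semilinear parts. The factor \<open>t - bar t\<close> can then be cancelled.\<close>

lemma linear_semilinear_separate:
  assumes "semilinear (\<lambda>c. c) L" "semilinear (\<lambda>c. c) L'" "semilinear bar S" "semilinear bar S'"
    and eq: "\<And>u. padd (L u) (S u) = padd (L' u) (S' u)"
  shows "L u = L' u" "S u = S' u"
proof -
  obtain t where t: "bar t \<noteq> t" using ex_not_fixed by blast
  have f: "fst (L u) + fst (S u) = fst (L' u) + fst (S' u)" "snd (L u) + snd (S u) = snd (L' u) + snd (S' u)" for u
    using eq[of u] by (simp_all add: padd_def)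
  have t1: "t * fst (L u) + bar t * fst (S u) = t * fst (L' u) + bar t * fst (S' u)"
    and t2: "t * snd (L u) + bar t * snd (S u) = t * snd (L' u) + bar t * snd (S' u)"
    using f[of "psmult t u"] assms(1-4)[THEN semilinearD, of t u] by (simp_all add: psmult_def)
  have "fst (S' u) = fst (L u) + fst (S u) - fst (L' u)" by (simp add: f(1))
  with t1 have "(t - bar t) * (fst (L u) - fst (L' u)) = 0" by (simp add: algebra_simps)
  then have 1: "fst (L u) = fst (L' u)" using t by simp
  have "snd (S' u) = snd (L u) + snd (S u) - snd (L' u)" by (simp add: f(2))
  with t2 have "(t - bar t) * (snd (L u) - snd (L' u)) = 0" by (simp add: algebra_simps)
  then have 2: "snd (L u) = snd (L' u)" using t by simp
  show "L u = L' u" using 1 2 by (simp add: prod_eq_iff)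
  show "S u = S' u" using 1 2 f[of u] by (simp add: prod_eq_iff)
qed

lemma invol_product_not_swapped:
  assumes D: "bar D = D" "D \<noteq> 0" "D \<noteq> 1" and h: "h \<in> Sp2_ext_2 q" and k: "k \<in> Sp2_ext_2 q"
  defines "x \<equiv> invol 1 1 0" and "y \<equiv> invol D D ((1 + D\<^sup>2) / D)"
  shows "x \<circ> y \<noteq> (k \<circ> y \<circ> inv\<^bsub>Sp4 q\<^esub> k) \<circ> (h \<circ> x \<circ> inv\<^bsub>Sp4 q\<^esub> h)"
proof
  assume eq: "x \<circ> y = (k \<circ> y \<circ> inv\<^bsub>Sp4 q\<^esub> k) \<circ> (h \<circ> x \<circ> inv\<^bsub>Sp4 q\<^esub> h)"
  define s where "s = (1 + D\<^sup>2) / D"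
  have s: "bar s = s" by (simp add: s_def D)
  define m where "m = nu 1 0"
  define n where "n = nu D s"
  define m' where "m' u = h (nu 1 0 ((inv\<^bsub>Sp4 q\<^esub> h) u))" for u
  define n' where "n' u = k (nu D s ((inv\<^bsub>Sp4 q\<^esub> k) u))" for u
  have m'sl: "semilinear bar m'" and n'sl: "semilinear bar n'"
    using conj_invol(2)[OF h bar_1] conj_invol(2)[OF k D(1)] by (simp_all add: m'_def n'_def semilinear_def)
  have n'add: "n' (padd u v) = padd (n' u) (n' v)" for u v
    using conj_invol(3)[OF k D(1)] by (simp add: n'_def)
  have main: "padd (psmult D (padd (psmult 1 u) (m' u))) (n' (padd (psmult 1 u) (m' u))) = x (y u)" for u
  proof -
    have "x (y u) = k (y ((inv\<^bsub>Sp4 q\<^esub> k) (h (x ((inv\<^bsub>Sp4 q\<^esub> h) u)))))"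
      using fun_cong[OF eq, of u] by simp
    then show ?thesis
      unfolding x_def y_def conj_invol(1)[OF h bar_1] conj_invol(1)[OF k D(1)] by (simp add: m'_def n'_def s_def)
  qed
  let ?L = "\<lambda>u. padd (psmult D u) (m (n u))" and ?S = "\<lambda>u. padd (n u) (psmult D (m u))"
    and ?L' = "\<lambda>u. padd (psmult D u) (n' (m' u))" and ?S' = "\<lambda>u. padd (n' u) (psmult D (m' u))"
  have "padd (?L u) (?S u) = padd (?L' u) (?S' u)" for u
  proof -
    have "padd (?L u) (?S u) = x (y u)"
      by (simp add: x_def y_def s_def[symmetric] invol_def m_def n_def nu_def padd_def psmult_def D algebra_simps)
    also have "\<dots> = padd (?L' u) (?S' u)"
      unfolding main[of u, symmetric] n'add by (simp add: padd_def psmult_def algebra_simps)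
    finally show ?thesis .
  qed
  \<comment> \<open>Composing two \<open>bar\<close>-semilinear maps gives a \<open>K\<close>-linear
    one, since \<open>bar (bar c) = c\<close>.\<close>
  moreover have "semilinear (\<lambda>c. c) ?L" "semilinear bar ?S"
    by (auto intro!: semilinearI simp: m_def n_def nu_def padd_def psmult_def algebra_simps)
  moreover have "semilinear (\<lambda>c. c) ?L'" "semilinear bar ?S'"
    by (auto intro!: semilinearI simp: semilinearD[OF m'sl] semilinearD[OF n'sl])
      (auto simp: padd_def psmult_def algebra_simps)
  ultimately have L: "?L u = ?L' u" and S: "?S u = ?S' u" for u
    using linear_semilinear_separate[of ?L ?L' ?S ?S'] by blast+
  let ?w = "m' (1, 0)"
  \<comment> \<open>At \<open>?w\<close> the term \<open>D m'\<close> drops out of the semilinear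
    identity, which expresses the unknown \<open>n' ?w\<close> through the explicit maps
    \<open>n\<close> and \<open>m\<close>.\<close>
  have "m' ?w = (0, 0)" using conj_nu_square_0[OF h] by (simp add: m'_def)
  then have n'w: "n' ?w = padd (n ?w) (psmult D (m ?w))" using S[of ?w] by (simp add: padd_def psmult_def)
  have "fst (m (n (1, 0))) = fst (n' ?w)" using L[of "(1, 0)"] by (simp add: padd_def prod_eq_iff)
  \<comment> \<open>Both summands have first component \<open>D * bar (snd ?w)\<close>, so they
    cancel whatever \<open>?w\<close> is.\<close>
  also have "\<dots> = 0" unfolding n'w by (simp add: n_def m_def nu_def padd_def psmult_def double_eq_0)
  finally have "s = 0" by (simp add: m_def n_def nu_def s)
  then have "1 + D\<^sup>2 = 0" using D(2) by (simp add: s_def)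
  moreover have "1 + D\<^sup>2 = (1 + D)\<^sup>2"
    using double_eq_0[of D] by (simp add: power2_eq_square algebra_simps)
  ultimately have "1 + D = 0" by simp
  then show False using D(3) eq_if_add_eq_0[of 1 D] by simp
qed

end

theorem theorem5p1:
  fixes e :: nat
  assumes "e > 1"
    and "card (UNIV :: 'K::{field,finite} set) = (2 ^ e) ^ 2"
  shows "\<not> strong_gelfand_pair (Sp4 (2 ^ e) :: ('K \<times> 'K \<Rightarrow> 'K \<times> 'K) monoid) (Sp2_ext_2 (2 ^ e))"
proof
  define q :: nat where "q = 2 ^ e"
  define bar :: "'K \<Rightarrow> 'K" where "bar x = x ^ q" for x
  let ?G = "Sp4 q :: ('K \<times> 'K \<Rightarrow> 'K \<times> 'K) monoid"
  assume "strong_gelfand_pair (Sp4 (2 ^ e) :: ('K \<times> 'K \<Rightarrow> 'K \<times> 'K) monoid) (Sp2_ext_2 (2 ^ e))"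
  then have sgp: "strong_gelfand_pair ?G (Sp2_ext_2 q)" by (simp add: q_def)
  interpret quadratic_extension e q bar
    by unfold_locales (use assms in \<open>simp_all add: q_def bar_def\<close>)
  interpret group ?G by (rule group_Sp4)
  have fin: "finite (carrier ?G)" by (rule finite_subset[OF subset_UNIV finite_class.finite_UNIV])
  obtain D where D: "bar D = D" "D \<noteq> 0" "D \<noteq> 1" using ex_fixed_not_0_1 by blast
  let ?x = "invol 1 1 0" and ?y = "invol D D ((1 + D\<^sup>2) / D)"
  \<comment> \<open>The condition \<open>r * s = 1 + C\<^sup>2\<close> reads
    \<open>0 = 1 + 1\<close> here.\<close>
  have "?x \<in> Sp4_carrier q" by (rule invol_in_Sp4) (simp_all add: double_eq_0)
  then have x: "?x \<in> carrier ?G" by (simp add: Sp4_def)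
  have "?y \<in> Sp4_carrier q" by (rule invol_in_Sp4) (simp_all add: D)
  then have y: "?y \<in> carrier ?G" by (simp add: Sp4_def)
  have mult: "g \<otimes>\<^bsub>?G\<^esub> h = g \<circ> h" for g h by (simp add: Sp4_def)
  from strong_gelfand_pair_swap_conjugates[OF fin subgroup_Sp2_ext_2 sgp x y] show False
    unfolding mult using invol_product_not_swapped[OF D] by blast
qed

end
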